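(* Let $n\ge 1$ be an integer, $p>2$, $t_0<0$ and \[ \Theta=\{(x,t)\in\mathbf{R}^{n}\times\mathbf{R}: |x|<\zeta(t) \text{ and } t_0<t<0\}, \] where $\zeta$ is a positive continuous function on $(t_0,0)$ such that $\Theta$ is bounded and \[ \liminf_{t\to 0^-}(-t)^{-1/p}\zeta(t)>0. \] Then the origin $(0,0)$ is irregular with respect to $\Theta$ (for the $p$-parabolic equation $\partial_t u-\operatorname{div}(|\nabla u|^{p-2}\nabla u)=0$). Moreover, there is no traditional barrier at $(0,0)$ for $\Theta$.
   Context: The $p$-parabolic equation is $\partial_t u-\Delta_p u:=\partial_t u-\operatorname{div}(|\nabla u|^{p-2}\nabla u)=0$; gradient and divergence are taken with respect to $x\in\mathbf{R}^n$ only. Let $\Theta\subset\mathbf{R}^{n+1}$ be a nonempty bounded open set, $\partial\Theta$ its (topological) boundary in $\mathbf{R}^{n+1}$. For open $U\subset\mathbf{R}^n$ and $t_1<t_2$, put $U_{t_1,t_2}=U\times(t_1,t_2)$, with parabolic boundary $\partial_p U_{t_1,t_2}=(\overline U\times\{t_1\})\cup(\partial U\times(t_1,t_2])$. The space $L^p(t_1,t_2;W^{1,p}(U))$ consists of functions $u(x,t)$ with $u(\cdot,t)\in W^{1,p}(U)$ for a.e. $t\in(t_1,t_2)$ and $\int_{t_1}^{t_2}\int_U(|u|^p+|\nabla u|^p)\,dx\,dt<\infty$. The space $C([t_1,t_2];L^2(U))$ consists of functions $u(x,t)$ such that $t\mapsto\int_U|u(x,t)|^2\,dx$ is continuous on $[t_1,t_2]$.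 Weak solution: $u:\Theta\to[-\infty,\infty]$ is a weak solution if for every open cylinder $U_{t_1,t_2}\Subset\Theta$ we have $u\in C([t_1,t_2];L^2(U))\cap L^p(t_1,t_2;W^{1,p}(U))$ and $\int_{t_1}^{t_2}\int_U|\nabla u|^{p-2}\nabla u\cdot\nabla\varphi\,dx\,dt-\int_{t_1}^{t_2}\int_U u\,\partial_t\varphi\,dx\,dt=0$ for all $\varphi\in C_0^\infty(U_{t_1,t_2})$. A $p$-parabolic function is a continuous weak solution. A function $u:\Theta\to(-\infty,\infty]$ is $p$-superparabolic if (i) $u$ is lower semicontinuous; (ii) $u$ is finite in a dense subset of $\Theta$; (iii) for every space-time box $Q_{t_1,t_2}=Q\times(t_1,t_2)\Subset\Theta$, with $Q=(a_1,b_1)\times\cdots\times(a_n,b_n)$, if $h$ is $p$-parabolic in $Q_{t_1,t_2}$, continuous on $\overline{Q}_{t_1,t_2}$ and $h\le u$ on $\partial_pQ_{t_1,t_2}$, then $h\le u$ in $Q_{t_1,t_2}$. Upper Perron solution: for bounded $f:\partial\Theta\to\mathbf{R}$, let $\mathcal{U}_f(\Theta)$ be the set of all $p$-superparabolic functions $u$ on $\Theta$ that are bounded below and satisfy $\liminf_{\Theta\ni\eta\to\xi}u(\eta)\ge f(\xi)$ for all $\xi\in\partial\Theta$; put $\overline{H}f(\xi)=\inf_{u\in\mathcal{U}_f(\Theta)}u(\xi)$ for $\xi\in\Theta$. A boundary point $\xi_0\in\partial\Theta$ is regular with respect to $\Theta$ if $\lim_{\Theta\ni\xi\to\xi_0}\overline{H}f(\xi)=f(\xi_0)$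 for every continuous $f:\partial\Theta\to\mathbf{R}$; otherwise it is irregular. A traditional barrier at $\xi_0\in\partial\Theta$ for $\Theta$ is a function $u$ such that (a) $u$ is a positive $p$-superparabolic function in $\Theta$; (b) $\lim_{\Theta\ni\zeta\to\xi_0}u(\zeta)=0$; (c) $\liminf_{\Theta\ni\zeta\to\xi}u(\zeta)>0$ for all $\xi\in\partial\Theta\setminus\{\xi_0\}$. *)

theory Defs
  imports "HOL-Analysis.Analysis"
begin

section \<open>Test functions\<close>

text \<open>Continuous differentiability of order k on the whole space, by recursion over the
  partial derivatives.\<close>

primrec Ck :: "nat \<Rightarrow> ('a::euclidean_space \<Rightarrow> real) \<Rightarrow> bool" where
  "Ck 0 f = continuous_on UNIV f"
| "Ck (Suc k) f =
     ((\<forall>x. f differentiable (at x)) \<and>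
      (\<forall>b\<in>Basis. Ck k (\<lambda>x. frechet_derivative f (at x) b)))"

text \<open>The space of smooth functions with compact support in U; its members are taken to be
  extended by zero to the whole space.\<close>

definition test_functions :: "'a::euclidean_space set \<Rightarrow> ('a \<Rightarrow> real) set" where
  "test_functions U =
     {\<phi>. (\<forall>k. Ck k \<phi>) \<and> compact (closure {x. \<phi> x \<noteq> 0}) \<and> closure {x. \<phi> x \<noteq> 0} \<subseteq> U}"

definition grad :: "(real^'n \<Rightarrow> real) \<Rightarrow> real^'n \<Rightarrow> real^'n" where
  "grad v x = (\<chi> i. frechet_derivative v (at x) (axis i 1))"


section \<open>Sobolev and parabolic function spaces\<close>

definition Lp_space :: "real \<Rightarrow> 'a::euclidean_space set \<Rightarrow> ('a \<Rightarrow> 'b::euclidean_space) set" where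
  "Lp_space p U =
     {v. v \<in> borel_measurable (lebesgue_on U) \<and>
         integrable (lebesgue_on U) (\<lambda>x. norm (v x) powr p)}"

definition locally_integrable :: "'a::euclidean_space set \<Rightarrow> ('a \<Rightarrow> 'b::euclidean_space) \<Rightarrow> bool" where
  "locally_integrable U v \<longleftrightarrow>
     (\<forall>K. compact K \<and> K \<subseteq> U \<longrightarrow> integrable (lebesgue_on K) v)"

definition weak_gradient ::
  "(real^'n) set \<Rightarrow> (real^'n \<Rightarrow> real) \<Rightarrow> (real^'n \<Rightarrow> real^'n) \<Rightarrow> bool" where
  "weak_gradient U v g \<longleftrightarrow>
     locally_integrable U v \<and> locally_integrable U g \<and>
     (\<forall>\<phi>\<in>test_functions U.
        (LINT x|lebesgue_on U. v x *\<^sub>R grad \<phi> x) =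
        - (LINT x|lebesgue_on U. \<phi> x *\<^sub>R g x))"

text \<open>Functions take extended real values. Since real_of_ereal sends both infinities to 0,
  finiteness almost everywhere has to be required separately.\<close>

definition W1p :: "real \<Rightarrow> (real^'n) set \<Rightarrow> (real^'n \<Rightarrow> ereal) set" where
  "W1p p U =
     {v. (AE x in lebesgue_on U. \<bar>v x\<bar> \<noteq> \<infinity>) \<and>
         (\<lambda>x. real_of_ereal (v x)) \<in> Lp_space p U \<and>
         (\<exists>g\<in>Lp_space p U. weak_gradient U (\<lambda>x. real_of_ereal (v x)) g)}"

text \<open>Membership in the space Lp(t1,t2; W1p(U)), where G is a jointly measurable version of the
  spatial weak gradient of u. It is determined by u up to a null set of the cylinder.\<close>

definition Lp_W1p_with_gradient ::
  "real \<Rightarrow> (real^'n) set \<Rightarrow> real \<Rightarrow> real \<Rightarrow>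
   ((real^'n) \<times> real \<Rightarrow> ereal) \<Rightarrow> ((real^'n) \<times> real \<Rightarrow> real^'n) \<Rightarrow> bool" where
  "Lp_W1p_with_gradient p U t1 t2 u G \<longleftrightarrow>
     u \<in> borel_measurable (lebesgue_on (U \<times> {t1<..<t2})) \<and>
     G \<in> borel_measurable (lebesgue_on (U \<times> {t1<..<t2})) \<and>
     (AE t in lebesgue_on {t1<..<t2}.
        (\<lambda>x. u (x, t)) \<in> W1p p U \<and>
        weak_gradient U (\<lambda>x. real_of_ereal (u (x, t))) (\<lambda>x. G (x, t))) \<and>
     integrable (lebesgue_on (U \<times> {t1<..<t2}))
       (\<lambda>z. \<bar>real_of_ereal (u z)\<bar> powr p + norm (G z) powr p)"

text \<open>Following the source, C([t1,t2]; L2(U)) only asks for continuity of the squared norm of the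
  time slices (not for continuity as a map into L2(U)).\<close>

definition C_L2 ::
  "(real^'n) set \<Rightarrow> real \<Rightarrow> real \<Rightarrow> ((real^'n) \<times> real \<Rightarrow> ereal) set" where
  "C_L2 U t1 t2 =
     {u. (\<forall>t\<in>{t1..t2}.
            (\<lambda>x. u (x, t)) \<in> borel_measurable (lebesgue_on U) \<and>
            (\<integral>\<^sup>+x. (e2ennreal \<bar>u (x, t)\<bar>)\<^sup>2 \<partial>lebesgue_on U) < \<infinity>) \<and>
         continuous_on {t1..t2} (\<lambda>t. \<integral>\<^sup>+x. (e2ennreal \<bar>u (x, t)\<bar>)\<^sup>2 \<partial>lebesgue_on U)}"


section \<open>The p-parabolic equation\<close>

definition compactly_contained :: "'a::euclidean_space set \<Rightarrow> 'a set \<Rightarrow> bool" (infix "\<Subset>" 50) where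
  "A \<Subset> B \<longleftrightarrow> compact (closure A) \<and> closure A \<subseteq> B"

definition weak_solution ::
  "real \<Rightarrow> ((real^'n) \<times> real) set \<Rightarrow> ((real^'n) \<times> real \<Rightarrow> ereal) \<Rightarrow> bool" where
  "weak_solution p \<Theta> u \<longleftrightarrow>
     (\<forall>U t1 t2. open U \<and> t1 < t2 \<and> U \<times> {t1<..<t2} \<Subset> \<Theta> \<longrightarrow>
        u \<in> C_L2 U t1 t2 \<and>
        (\<exists>G. Lp_W1p_with_gradient p U t1 t2 u G \<and>
             (\<forall>\<phi>\<in>test_functions (U \<times> {t1<..<t2}).
                (LINT (x, t)|lebesgue_on (U \<times> {t1<..<t2}).
                   (norm (G (x, t)) powr (p - 2) *\<^sub>R G (x, t)) \<bullet> grad (\<lambda>y. \<phi> (y, t)) x)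
                - (LINT (x, t)|lebesgue_on (U \<times> {t1<..<t2}).
                     real_of_ereal (u (x, t)) * deriv (\<lambda>s. \<phi> (x, s)) t) = 0)))"

text \<open>Continuity is understood as continuity of a finite-valued function, hence the type of h.\<close>

definition p_parabolic ::
  "real \<Rightarrow> ((real^'n) \<times> real) set \<Rightarrow> ((real^'n) \<times> real \<Rightarrow> real) \<Rightarrow> bool" where
  "p_parabolic p \<Theta> h \<longleftrightarrow> continuous_on \<Theta> h \<and> weak_solution p \<Theta> (\<lambda>z. ereal (h z))"

definition parabolic_boundary :: "(real^'n) set \<Rightarrow> real \<Rightarrow> real \<Rightarrow> ((real^'n) \<times> real) set" where
  "parabolic_boundary U t1 t2 = (closure U \<times> {t1}) \<union> (frontier U \<times> {t1<..t2})"

definition lsc_on :: "'a::topological_space set \<Rightarrow> ('a \<Rightarrow> ereal) \<Rightarrow> bool" where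
  "lsc_on S u \<longleftrightarrow> (\<forall>z\<in>S. u z \<le> Liminf (at z within S) u)"

text \<open>In this definition and all later ones, only the values of u on \<open>\<Theta>\<close> matter.\<close>

definition p_superparabolic ::
  "real \<Rightarrow> ((real^'n) \<times> real) set \<Rightarrow> ((real^'n) \<times> real \<Rightarrow> ereal) \<Rightarrow> bool" where
  "p_superparabolic p \<Theta> u \<longleftrightarrow>
     (\<forall>z\<in>\<Theta>. u z \<noteq> -\<infinity>) \<and>
     lsc_on \<Theta> u \<and>
     \<Theta> \<subseteq> closure {z\<in>\<Theta>. u z \<noteq> \<infinity>} \<and>
     (\<forall>a b t1 t2 h.
        (\<forall>i. a $ i < b $ i) \<and> t1 < t2 \<and> box a b \<times> {t1<..<t2} \<Subset> \<Theta> \<and>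
        p_parabolic p (box a b \<times> {t1<..<t2}) h \<and>
        continuous_on (closure (box a b \<times> {t1<..<t2})) h \<and>
        (\<forall>z\<in>parabolic_boundary (box a b) t1 t2. ereal (h z) \<le> u z) \<longrightarrow>
        (\<forall>z\<in>box a b \<times> {t1<..<t2}. ereal (h z) \<le> u z))"


section \<open>Perron solutions, boundary regularity and barriers\<close>

definition upper_class ::
  "real \<Rightarrow> ((real^'n) \<times> real) set \<Rightarrow> ((real^'n) \<times> real \<Rightarrow> real) \<Rightarrow>
   ((real^'n) \<times> real \<Rightarrow> ereal) set" where
  "upper_class p \<Theta> f =
     {u. p_superparabolic p \<Theta> u \<and>
         (\<exists>m::real. \<forall>z\<in>\<Theta>. ereal m \<le> u z) \<and>
         (\<forall>\<xi>\<in>frontier \<Theta>. ereal (f \<xi>) \<le> Liminf (at \<xi> within \<Theta>) u)}"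

definition upper_perron ::
  "real \<Rightarrow> ((real^'n) \<times> real) set \<Rightarrow> ((real^'n) \<times> real \<Rightarrow> real) \<Rightarrow> (real^'n) \<times> real \<Rightarrow> ereal" where
  "upper_perron p \<Theta> f \<xi> = (INF u\<in>upper_class p \<Theta> f. u \<xi>)"

text \<open>These notions are used for nonempty bounded open \<open>\<Theta>\<close>, so that \<open>frontier \<Theta>\<close> is compact and
  the continuous boundary data f below are bounded.\<close>

definition regular_point :: "real \<Rightarrow> ((real^'n) \<times> real) set \<Rightarrow> (real^'n) \<times> real \<Rightarrow> bool" where
  "regular_point p \<Theta> \<xi>0 \<longleftrightarrow>
     \<xi>0 \<in> frontier \<Theta> \<and>
     (\<forall>f. continuous_on (frontier \<Theta>) f \<longrightarrow>
        (upper_perron p \<Theta> f \<longlongrightarrow> ereal (f \<xi>0)) (at \<xi>0 within \<Theta>))"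

definition irregular_point :: "real \<Rightarrow> ((real^'n) \<times> real) set \<Rightarrow> (real^'n) \<times> real \<Rightarrow> bool" where
  "irregular_point p \<Theta> \<xi>0 \<longleftrightarrow> \<xi>0 \<in> frontier \<Theta> \<and> \<not> regular_point p \<Theta> \<xi>0"

definition traditional_barrier ::
  "real \<Rightarrow> ((real^'n) \<times> real) set \<Rightarrow> (real^'n) \<times> real \<Rightarrow> ((real^'n) \<times> real \<Rightarrow> ereal) \<Rightarrow> bool" where
  "traditional_barrier p \<Theta> \<xi>0 u \<longleftrightarrow>
     p_superparabolic p \<Theta> u \<and> (\<forall>z\<in>\<Theta>. 0 < u z) \<and>
     (u \<longlongrightarrow> 0) (at \<xi>0 within \<Theta>) \<and>
     (\<forall>\<xi>\<in>frontier \<Theta> - {\<xi>0}. 0 < Liminf (at \<xi> within \<Theta>) u)"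

end

theory Submission
  imports Defs
begin

text \<open>
  Write n for the dimension and q = p / (p - 2). For a suitable constant K > 0 the function

    \<open>h (x, t) = a - K |x|^q (- t)^(- 1 / (p - 2))\<close>

  is a solution of the p-parabolic equation for t < 0 (lemma \<open>p_parabolic_focusing\<close>). It equals a
  on the axis x = 0 for all times and is positive exactly in a paraboloid \<open>|x| < \<rho> (- t)^(1/p)\<close>,
  where \<open>K \<rho>^q = a\<close>. The hypothesis on \<zeta> says that near the origin \<Theta> contains some paraboloid of this
  shape. Because p > 2, small amplitudes a correspond to small \<rho>, so the set where h is positive
  fits into \<Theta> when a is small; diffusion of small data is too slow to notice the shrinking lateral
  boundary. Hence a nonnegative superparabolic function v with v \<ge> a on an early time slice stays
  above h, and so v \<ge> a at points of the axis that converge to the origin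
  (lemma \<open>superparabolic_axis_lower_bound\<close>).

  A traditional barrier is positive, hence bounded below by a positive constant on a compact part of
  a time slice, and so it cannot tend to 0 at the origin. For irregularity consider the boundary
  values f (x, t) = - t. Every v in the upper class of f satisfies v \<ge> - t in \<Theta>
  (lemma \<open>superparabolic_boundary_minimum_principle\<close>), so v is nonnegative and has a positive lower bound
  on a time slice that does not depend on v. Thus the upper Perron solution stays above a fixed a > 0
  along the axis, whereas f vanishes at the origin.

  Superparabolic functions are compared with solutions only on boxes, whereas h lives on a paraboloid.
  The paraboloid is therefore descended through overlapping boxes that shrink with it, and the minimum
  principle for v + t is obtained by placing a translate of h in one small box around a negative
  minimum.
\<close>

section \<open>Powers of the norm\<close>

text \<open>For r < 1 the factor \<open>norm (x - c) powr (r - 1)\<close> blows up at c, but the whole vector has norm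
  \<open>norm (x - c) powr r\<close>. This covers the gradient of \<open>norm (x - c) powr q\<close> for all q > 1,
  hence for all p > 2.\<close>

lemma continuous_on_norm_powr_scaleR:
  fixes c :: "'a::real_normed_vector"
  assumes "r > 0"
  shows "continuous_on UNIV (\<lambda>x. norm (x - c) powr (r - 1) *\<^sub>R (x - c))"
proof -
  have "isCont (\<lambda>x. norm (x - c) powr (r - 1) *\<^sub>R (x - c)) x" for x
  proof (cases "x = c")
    case True
    have "((\<lambda>x. norm (x - c) powr r) \<longlongrightarrow> norm (c - c) powr r) (at c)"
      using assms by (intro tendsto_intros) auto
    moreover have "norm (norm (x - c) powr (r - 1) *\<^sub>R (x - c)) = norm (x - c) powr r" for x
      by (cases "x = c") (auto simp: powr_diff)
    ultimately have "((\<lambda>x. norm (x - c) powr (r - 1) *\<^sub>R (x - c)) \<longlongrightarrow> 0) (at c)"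
      by (subst tendsto_norm_zero_iff[symmetric]) simp
    with True show ?thesis by (simp add: isCont_def)
  next
    case False
    then show ?thesis by (intro continuous_intros) auto
  qed
  then show ?thesis by (simp add: continuous_at_imp_continuous_on)
qed

lemma has_derivative_norm_powr:
  fixes c :: "'a::real_inner"
  assumes "q > 1"
  shows "((\<lambda>x. norm (x - c) powr q) has_derivative
      (\<lambda>k. q * norm (x - c) powr (q - 2) * ((x - c) \<bullet> k))) (at x)"
proof (cases "x = c")
  case False
  have n: "((\<lambda>x. norm (x - c)) has_derivative (\<lambda>k. k \<bullet> sgn (x - c))) (at x)"
  proof (rule has_derivative_compose[where f="\<lambda>x. x - c" and f'="\<lambda>k. k"])
    show "((\<lambda>x. x - c) has_derivative (\<lambda>k. k)) (at x)"
      by (auto intro!: derivative_eq_intros)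
    show "(norm has_derivative (\<lambda>k. k \<bullet> sgn (x - c))) (at (x - c))"
      using GDERIV_norm[of "x - c"] False by (simp add: gderiv_def)
  qed
  have "((\<lambda>y. y powr q) has_real_derivative q * norm (x - c) powr (q - 1)) (at (norm (x - c)))"
    using False by (intro has_real_derivative_powr) auto
  from has_derivative_compose[OF n this[unfolded has_field_derivative_def]]
  have "((\<lambda>x. norm (x - c) powr q) has_derivative
      (\<lambda>k. q * norm (x - c) powr (q - 1) * (k \<bullet> sgn (x - c)))) (at x)" .
  moreover have "q * norm (x - c) powr (q - 1) * (k \<bullet> sgn (x - c)) =
      q * norm (x - c) powr (q - 2) * ((x - c) \<bullet> k)" for k
  proof -
    have "norm (x - c) powr (q - 1) = norm (x - c) powr (q - 2) * norm (x - c)"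
      using False powr_add[of "norm (x - c)" "q - 2" 1] by simp
    moreover have "norm (x - c) * (k \<bullet> sgn (x - c)) = (x - c) \<bullet> k"
      using False by (simp add: sgn_div_norm inner_commute)
    ultimately show ?thesis by (metis mult.assoc)
  qed
  ultimately show ?thesis by simp
next
  case True
  have "((\<lambda>k. norm k powr (q - 1)) \<longlongrightarrow> norm (0::'a) powr (q - 1)) (at 0)"
    using assms by (intro tendsto_intros) (auto intro!: tendsto_norm_zero)
  moreover have "norm k powr q / norm k = norm k powr (q - 1)" for k :: 'a
    by (cases "k = 0") (auto simp: powr_diff)
  ultimately show ?thesis
    using True by (simp add: has_derivative_at)
qed

section \<open>Integration by parts against test functions\<close>

lemma has_derivative_imp_line_derivative:
  assumes "(f has_derivative f') (at z)"
  shows "((\<lambda>s. f (z + s *\<^sub>R e)) has_real_derivative f' e) (at 0)"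
proof -
  have "((\<lambda>s. f (z + s *\<^sub>R e)) has_derivative (\<lambda>s. f' (s *\<^sub>R e))) (at 0)"
    by (rule has_derivative_compose[where g=f and f="\<lambda>s::real. z + s *\<^sub>R e"])
      (auto intro!: derivative_eq_intros simp: assms)
  moreover have "f' (s *\<^sub>R e) = f' e * s" for s
    using linear_scale[OF has_derivative_linear[OF assms]] by simp
  ultimately show ?thesis by (simp add: has_field_derivative_def)
qed

text \<open>Translation invariance makes the integral of every difference quotient of g vanish. The mean value
  theorem bounds the quotients by a constant times the indicator of a fixed compact set, so the limit
  may be taken under the integral. Only the derivative in the single direction e is used, so that the
  rule applies to fluxes that are differentiated in one variable only.\<close>

lemma integral_directional_derivative_eq_0:
  fixes g g' :: "'a::euclidean_space \<Rightarrow> real"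
  assumes deriv: "\<And>x. ((\<lambda>s. g (x + s *\<^sub>R e)) has_real_derivative g' x) (at 0)"
    and cont: "continuous_on UNIV g" "continuous_on UNIV g'"
    and K: "compact K" "\<And>x. x \<notin> K \<Longrightarrow> g x = 0"
  shows "integral\<^sup>L lborel g' = 0"
proof -
  have g'0: "g' x = 0" if "x \<notin> K" for x
  proof -
    have "open ((\<lambda>s::real. x + s *\<^sub>R e) -` (- K))"
      using K(1) by (intro continuous_open_vimage continuous_intros open_Compl compact_imp_closed)
    then have "eventually (\<lambda>s. s \<in> (\<lambda>s::real. x + s *\<^sub>R e) -` (- K)) (nhds 0)"
      using that by (intro eventually_nhds_in_open) auto
    then have "eventually (\<lambda>s. g (x + s *\<^sub>R e) = 0) (nhds 0)"
      by eventually_elim (auto simp: K(2))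
    then have "((\<lambda>s. g (x + s *\<^sub>R e)) has_real_derivative 0) (at 0)"
      by (subst DERIV_cong_ev[OF refl _ refl, where g="\<lambda>_. 0"]) auto
    with deriv[of x] show ?thesis by (metis DERIV_unique)
  qed
  have "bounded (g' ` K)" using cont K
    by (meson compact_continuous_image compact_imp_bounded continuous_on_subset subset_UNIV)
  then obtain B where B: "B > 0" "\<And>x. x \<in> K \<Longrightarrow> \<bar>g' x\<bar> \<le> B"
    by (auto simp: bounded_pos)
  have B': "\<bar>g' x\<bar> \<le> B" for x using B g'0 by (cases "x \<in> K") auto
  \<comment> \<open>L contains the supports of all difference quotients with step at most
    1.\<close>
  define L where "L = (\<lambda>(s, x). x - s *\<^sub>R e) ` ({0..1::real} \<times> K)"
  have L: "compact L" unfolding L_def case_prod_unfold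
    using K by (intro compact_continuous_image continuous_intros compact_Times) auto
  have KL: "K \<subseteq> L" unfolding L_def by force
  define d where "d n x = real (Suc n) * (g (x + (1 / real (Suc n)) *\<^sub>R e) - g x)" for n x
  have int_g: "integrable lborel g"
  proof -
    have "integrable lborel (\<lambda>x. indicator K x *\<^sub>R g x)"
      using cont K by (intro borel_integrable_compact) (auto intro: continuous_on_subset)
    moreover have "(\<lambda>x. indicator K x *\<^sub>R g x) = g"
      using K by (intro ext) (auto simp: indicator_def)
    ultimately show ?thesis by simp
  qed
  have int_tr: "integrable lborel (\<lambda>x. g (x + h)) \<and> (LINT x|lborel. g (x + h)) = integral\<^sup>L lborel g" for h
  proof -
    have m: "g \<in> borel_measurable borel" using cont by (simp add: borel_measurable_continuous_onI)
    have "integrable (distr lborel borel ((+) h)) g = integrable lborel (\<lambda>x. g (h + x))"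
      using m by (subst integrable_distr_eq) auto
    moreover have "integral\<^sup>L (distr lborel borel ((+) h)) g = (LINT x|lborel. g (h + x))"
      using m by (subst integral_distr) auto
    ultimately show ?thesis using int_g by (simp add: lborel_distr_plus add.commute)
  qed
  have d_bd: "norm (d n x) \<le> indicator L x *\<^sub>R B" for n x
  proof (cases "x \<in> L")
    case True
    have "\<exists>z. 0 < z \<and> z < 1 / real (Suc n) \<and> g (x + (1 / real (Suc n)) *\<^sub>R e) - g (x + 0 *\<^sub>R e) =
        (1 / real (Suc n) - 0) * g' (x + z *\<^sub>R e)"
    proof (rule MVT2)
      fix s :: real
      have "((\<lambda>s'. g ((x + s *\<^sub>R e) + (s' - s) *\<^sub>R e)) has_real_derivative g' (x + s *\<^sub>R e)) (at s)"
      proof -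
        have "((\<lambda>r. g ((x + s *\<^sub>R e) + r *\<^sub>R e)) has_real_derivative g' (x + s *\<^sub>R e)) (at (s + - s))"
          using deriv[of "x + s *\<^sub>R e"] by simp
        then show ?thesis by (subst (asm) DERIV_shift) simp
      qed
      then show "((\<lambda>s. g (x + s *\<^sub>R e)) has_real_derivative g' (x + s *\<^sub>R e)) (at s)"
        by (simp add: algebra_simps)
    qed simp
    then obtain z where "g (x + (1 / real (Suc n)) *\<^sub>R e) - g x = (1 / real (Suc n)) * g' (x + z *\<^sub>R e)"
      by auto
    then have "d n x = g' (x + z *\<^sub>R e)" unfolding d_def by simp
    then show ?thesis using B'[of "x + z *\<^sub>R e"] True by simp
  next
    case False
    have "x + (1 / real (Suc n)) *\<^sub>R e \<notin> K"
    proof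
      assume "x + (1 / real (Suc n)) *\<^sub>R e \<in> K"
      then have "x \<in> L" unfolding L_def
        by (intro image_eqI[where x="(1 / real (Suc n), x + (1 / real (Suc n)) *\<^sub>R e)"]) auto
      with False show False by simp
    qed
    moreover have "x \<notin> K" using False KL by auto
    ultimately show ?thesis using False K(2) by (simp add: d_def)
  qed
  have lim: "(\<lambda>n. integral\<^sup>L lborel (d n)) \<longlonglongrightarrow> integral\<^sup>L lborel g'"
  proof (rule integral_dominated_convergence[where w="\<lambda>x. indicator L x *\<^sub>R B"])
    show "g' \<in> borel_measurable lborel" using cont by (simp add: borel_measurable_continuous_onI)
    show "d n \<in> borel_measurable lborel" for n unfolding d_def using cont
      by (simp, intro borel_measurable_continuous_onI continuous_intros continuous_on_compose2[OF cont(1)]) auto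
    show "integrable lborel (\<lambda>x. indicator L x *\<^sub>R B)"
      using L by (intro borel_integrable_compact) auto
    show "AE x in lborel. (\<lambda>n. d n x) \<longlonglongrightarrow> g' x"
    proof (rule AE_I2)
      fix x
      have "((\<lambda>h. (g (x + h *\<^sub>R e) - g x) / h) \<longlongrightarrow> g' x) (at 0)"
        using deriv[of x] by (simp add: DERIV_def)
      moreover have "filterlim (\<lambda>n. 1 / real (Suc n)) (at 0) sequentially"
        unfolding filterlim_at using LIMSEQ_inverse_real_of_nat by (auto simp: divide_inverse)
      ultimately have "(\<lambda>n. (g (x + (1 / real (Suc n)) *\<^sub>R e) - g x) / (1 / real (Suc n))) \<longlonglongrightarrow> g' x"
        by (rule filterlim_compose)
      then show "(\<lambda>n. d n x) \<longlonglongrightarrow> g' x" by (simp add: d_def mult.commute)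
    qed
  qed (use d_bd in auto)
  moreover have "integral\<^sup>L lborel (d n) = 0" for n
    unfolding d_def using int_tr int_g by simp
  ultimately show ?thesis by (simp add: LIMSEQ_const_iff)
qed

lemma integrable_lebesgue_on_continuous_compact_support:
  fixes F :: "'a::euclidean_space \<Rightarrow> 'b::euclidean_space"
  assumes "continuous_on V F" "compact K" "K \<subseteq> V" "\<And>x. x \<in> V \<Longrightarrow> x \<notin> K \<Longrightarrow> F x = 0"
    and V: "V \<in> sets lebesgue"
  shows "integrable (lebesgue_on V) F"
    and "integral\<^sup>L (lebesgue_on V) F = (LINT x|lborel. indicator K x *\<^sub>R F x)"
proof -
  have i: "integrable lborel (\<lambda>x. indicator K x *\<^sub>R F x)"
    using assms by (intro borel_integrable_compact) (auto intro: continuous_on_subset)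
  have e: "(\<lambda>x. indicator V x *\<^sub>R F x) = (\<lambda>x. indicator K x *\<^sub>R F x)"
    using assms(3,4) by (auto simp: indicator_def fun_eq_iff)
  have m: "(\<lambda>x. indicator K x *\<^sub>R F x) \<in> borel_measurable lborel"
    using i by (rule borel_measurable_integrable)
  show "integrable (lebesgue_on V) F"
    using i V m by (simp add: integrable_restrict_space e integrable_completion)
  show "integral\<^sup>L (lebesgue_on V) F = (LINT x|lborel. indicator K x *\<^sub>R F x)"
    using V m by (simp add: integral_restrict_space e integral_completion)
qed

lemma test_functions_differentiable:
  "\<phi> \<in> test_functions V \<Longrightarrow> \<phi> differentiable (at z)"
  by (auto simp: test_functions_def dest: spec[of _ "Suc 0"])

lemma test_functions_continuous_frechet_derivative:
  assumes "\<phi> \<in> test_functions V"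
  shows "continuous_on UNIV (\<lambda>z. frechet_derivative \<phi> (at z) e)"
proof -
  have lin: "linear (frechet_derivative \<phi> (at z))" for z
    using test_functions_differentiable[OF assms] by (simp add: linear_frechet_derivative)
  have "frechet_derivative \<phi> (at z) e = (\<Sum>b\<in>Basis. (e \<bullet> b) * frechet_derivative \<phi> (at z) b)" for z
    using linear_sum[OF lin, of z "\<lambda>b. (e \<bullet> b) *\<^sub>R b" Basis] linear_scale[OF lin, of z]
    by (simp add: euclidean_representation)
  moreover have "continuous_on UNIV (\<lambda>z. frechet_derivative \<phi> (at z) b)" if "b \<in> Basis" for b
    using assms that by (auto simp: test_functions_def dest: spec[of _ "Suc 0"])
  ultimately show ?thesis by (auto intro!: continuous_intros)
qed

lemma test_functions_vanish_outside_support: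
  assumes "z \<notin> closure {z. \<phi> z \<noteq> (0::real)}"
  shows "\<phi> z = 0" and "frechet_derivative \<phi> (at z) e = 0"
proof -
  have 0: "\<phi> y = 0" if "y \<notin> closure {z. \<phi> z \<noteq> 0}" for y
    using that closure_subset[of "{z. \<phi> z \<noteq> 0}"] by auto
  show "\<phi> z = 0" by (rule 0[OF assms])
  have "(\<phi> has_derivative (\<lambda>_. 0)) (at z)"
  proof (rule has_derivative_transform_within_open[OF has_derivative_const])
    show "open (- closure {z. \<phi> z \<noteq> 0})" by (rule open_Compl[OF closed_closure])
    show "z \<in> - closure {z. \<phi> z \<noteq> 0}" using assms by simp
    show "0 = \<phi> y" if "y \<in> - closure {z. \<phi> z \<noteq> 0}" for y using 0[OF ComplD[OF that]] by (rule sym)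
  qed
  then show "frechet_derivative \<phi> (at z) e = 0" by (simp add: frechet_derivative_at[symmetric])
qed

lemma integrable_lebesgue_on_subset_compact:
  fixes f :: "'a::euclidean_space \<Rightarrow> 'b::euclidean_space"
  assumes "continuous_on K f" "compact K" "V \<subseteq> K" "V \<in> sets lebesgue"
  shows "integrable (lebesgue_on V) f"
proof -
  have i: "integrable lborel (\<lambda>x. indicator K x *\<^sub>R f x)"
    using assms by (intro borel_integrable_compact)
  then have "integrable lebesgue (\<lambda>x. indicator K x *\<^sub>R f x)"
    using integrable_completion[of "\<lambda>x. indicator K x *\<^sub>R f x" lborel]
      borel_measurable_integrable[OF i] by blast
  then have "integrable lebesgue (\<lambda>x. indicator V x *\<^sub>R (indicator K x *\<^sub>R f x))"
    using assms(4) by (rule integrable_mult_indicator[rotated])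
  moreover have "(\<lambda>x. indicator V x *\<^sub>R (indicator K x *\<^sub>R f x)) = (\<lambda>x. indicator V x *\<^sub>R f x)"
    using assms(3) by (auto simp: fun_eq_iff indicator_def)
  ultimately show ?thesis using assms(4) by (simp add: integrable_restrict_space)
qed

text \<open>The product of w and the test function, extended by zero, is a compactly supported function to which
  the vanishing of integrals of derivatives applies. It suffices that w is defined and differentiable
  on V because the support of the test function is a compact subset of V; this matters for solutions
  that exist only before a blow-up time.\<close>

lemma integration_by_parts_test_function:
  fixes w w' :: "'a::euclidean_space \<Rightarrow> real"
  assumes \<phi>: "\<phi> \<in> test_functions V" and V: "open V"
    and deriv: "\<And>z. z \<in> V \<Longrightarrow> ((\<lambda>s. w (z + s *\<^sub>R e)) has_real_derivative w' z) (at 0)"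
    and cont: "continuous_on V w" "continuous_on V w'"
  shows "integrable (lebesgue_on V) (\<lambda>z. w z * frechet_derivative \<phi> (at z) e)"
    and "integrable (lebesgue_on V) (\<lambda>z. \<phi> z * w' z)"
    and "(LINT z|lebesgue_on V. w z * frechet_derivative \<phi> (at z) e) =
         - (LINT z|lebesgue_on V. \<phi> z * w' z)"
proof -
  define D where "D z = frechet_derivative \<phi> (at z) e" for z
  define K where "K = closure {z. \<phi> z \<noteq> 0}"
  have K: "compact K" "K \<subseteq> V" using \<phi> by (auto simp: test_functions_def K_def)
  have \<phi>0: "\<phi> z = 0" and D0: "D z = 0" if "z \<notin> K" for z
    unfolding D_def using test_functions_vanish_outside_support[of z \<phi>] that by (simp_all add: K_def)
  have oK: "open (- K)" using K(1) by (simp add: compact_imp_closed open_Compl)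
  have contD: "continuous_on X D" for X
    using test_functions_continuous_frechet_derivative[OF \<phi>, of e] unfolding D_def
    by (rule continuous_on_subset) auto
  have diff\<phi>: "(\<phi> has_derivative frechet_derivative \<phi> (at z)) (at z)" for z
    using test_functions_differentiable[OF \<phi>] by (simp add: frechet_derivative_works)
  have cont\<phi>: "continuous_on X \<phi>" for X
    using diff\<phi> by (meson continuous_at_imp_continuous_on has_derivative_continuous)
  have line\<phi>: "((\<lambda>s. \<phi> (z + s *\<^sub>R e)) has_real_derivative D z) (at 0)" for z
    unfolding D_def by (rule has_derivative_imp_line_derivative[OF diff\<phi>])
  define g where "g z = (if z \<in> V then w z * \<phi> z else 0)" for z
  define g' where "g' z = (if z \<in> V then w z * D z + \<phi> z * w' z else 0)" for z
  have g0: "g z = 0" "g' z = 0" if "z \<notin> K" for z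
    using that by (auto simp: g_def g'_def \<phi>0 D0)
  have UN: "V \<union> - K = UNIV" using K by auto
  have cg: "continuous_on UNIV g" "continuous_on UNIV g'"
  proof -
    have "continuous_on V g \<longleftrightarrow> continuous_on V (\<lambda>z. w z * \<phi> z)"
      by (rule continuous_on_cong) (auto simp: g_def)
    moreover have "continuous_on (- K) g \<longleftrightarrow> continuous_on (- K) (\<lambda>z. 0::real)"
      by (rule continuous_on_cong) (auto simp: g0)
    ultimately have "continuous_on (V \<union> - K) g"
      using V oK cont cont\<phi> by (intro continuous_on_open_Un) (auto intro!: continuous_intros)
    then show "continuous_on UNIV g" using UN by simp
    have "continuous_on V g' \<longleftrightarrow> continuous_on V (\<lambda>z. w z * D z + \<phi> z * w' z)"
      by (rule continuous_on_cong) (auto simp: g'_def)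
    moreover have "continuous_on (- K) g' \<longleftrightarrow> continuous_on (- K) (\<lambda>z. 0::real)"
      by (rule continuous_on_cong) (auto simp: g0)
    ultimately have "continuous_on (V \<union> - K) g'"
      using V oK cont cont\<phi> contD by (intro continuous_on_open_Un) (auto intro!: continuous_intros)
    then show "continuous_on UNIV g'" using UN by simp
  qed
  have dg: "((\<lambda>s. g (z + s *\<^sub>R e)) has_real_derivative g' z) (at 0)" for z
  proof (cases "z \<in> V")
    case True
    have d: "((\<lambda>s. w (z + s *\<^sub>R e) * \<phi> (z + s *\<^sub>R e)) has_real_derivative g' z) (at 0)"
      using DERIV_mult[OF deriv[OF True] line\<phi>[of z]] True by (simp add: g'_def algebra_simps)
    have "open ((\<lambda>s::real. z + s *\<^sub>R e) -` V)"
      using V by (intro continuous_open_vimage continuous_intros)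
    then have "eventually (\<lambda>s. s \<in> (\<lambda>s::real. z + s *\<^sub>R e) -` V) (nhds 0)"
      using True by (intro eventually_nhds_in_open) auto
    then have "eventually (\<lambda>s. g (z + s *\<^sub>R e) = w (z + s *\<^sub>R e) * \<phi> (z + s *\<^sub>R e)) (nhds 0)"
      by eventually_elim (auto simp: g_def)
    from DERIV_cong_ev[OF refl this refl] d show ?thesis by simp
  next
    case False
    then have "z \<in> - K" using K by auto
    have "open ((\<lambda>s::real. z + s *\<^sub>R e) -` (- K))"
      by (intro continuous_open_vimage[OF oK] continuous_intros)
    then have "eventually (\<lambda>s. s \<in> (\<lambda>s::real. z + s *\<^sub>R e) -` (- K)) (nhds 0)"
      using \<open>z \<in> - K\<close> by (intro eventually_nhds_in_open) auto
    then have "eventually (\<lambda>s. g (z + s *\<^sub>R e) = 0) (nhds 0)"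
      by eventually_elim (auto simp: g0)
    from DERIV_cong_ev[OF refl this refl, of "g' z"] False show ?thesis by (simp add: g'_def)
  qed
  have z: "integral\<^sup>L lborel g' = 0"
    by (rule integral_directional_derivative_eq_0[OF dg cg K(1) g0(1)])
  have Vm: "V \<in> sets lebesgue" using V by simp
  have 1: "integrable (lebesgue_on V) (\<lambda>z. w z * D z)"
    by (rule integrable_lebesgue_on_continuous_compact_support[OF _ K _ Vm])
      (use D0 cont contD in \<open>auto intro!: continuous_intros\<close>)
  have 2: "integrable (lebesgue_on V) (\<lambda>z. \<phi> z * w' z)"
    by (rule integrable_lebesgue_on_continuous_compact_support[OF _ K _ Vm])
      (use \<phi>0 cont cont\<phi> in \<open>auto intro!: continuous_intros\<close>)
  have "integral\<^sup>L (lebesgue_on V) g' = (LINT x|lborel. indicator K x *\<^sub>R g' x)"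
    using cg g0 by (intro integrable_lebesgue_on_continuous_compact_support(2)[OF _ K _ Vm])
      (auto intro: continuous_on_subset)
  also have "(\<lambda>x. indicator K x *\<^sub>R g' x) = g'"
    using g0 by (auto simp: fun_eq_iff indicator_def)
  also have "integral\<^sup>L (lebesgue_on V) g' = (LINT z|lebesgue_on V. w z * D z + \<phi> z * w' z)"
    by (rule Bochner_Integration.integral_cong) (auto simp: g'_def)
  finally have 3: "(LINT z|lebesgue_on V. w z * D z) + (LINT z|lebesgue_on V. \<phi> z * w' z) = 0"
    using z 1 2 by simp
  show "integrable (lebesgue_on V) (\<lambda>z. w z * frechet_derivative \<phi> (at z) e)"
    "integrable (lebesgue_on V) (\<lambda>z. \<phi> z * w' z)"
    "(LINT z|lebesgue_on V. w z * frechet_derivative \<phi> (at z) e) =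
         - (LINT z|lebesgue_on V. \<phi> z * w' z)"
    using 1 2 3 by (auto simp: D_def)
qed

section \<open>Membership in the function spaces\<close>

lemma weak_gradient_continuously_differentiable:
  fixes v :: "real^'n \<Rightarrow> real"
  assumes v: "\<And>x. (v has_derivative (\<lambda>k. g x \<bullet> k)) (at x)"
    and g: "continuous_on UNIV g" and U: "open U"
  shows "weak_gradient U v g"
  unfolding weak_gradient_def
proof (intro conjI ballI)
  have cv: "continuous_on X v" for X
    using v by (meson continuous_at_imp_continuous_on has_derivative_continuous)
  have cg: "continuous_on X g" for X
    using g continuous_on_subset by blast
  show "locally_integrable U v" "locally_integrable U g"
    unfolding locally_integrable_def
    using cv cg by (auto intro!: integrable_lebesgue_on_subset_compact simp: compact_imp_closed)
  fix \<phi> assume \<phi>: "\<phi> \<in> test_functions U"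
  define K where "K = closure {z. \<phi> z \<noteq> 0}"
  have K: "compact K" "K \<subseteq> U" using \<phi> by (auto simp: test_functions_def K_def)
  have \<phi>0: "\<phi> z = 0" and D0: "frechet_derivative \<phi> (at z) e = 0" if "z \<notin> K" for z e
    using test_functions_vanish_outside_support[of z \<phi>] that by (simp_all add: K_def)
  have c\<phi>: "continuous_on X \<phi>" for X
    using test_functions_differentiable[OF \<phi>]
    by (meson continuous_at_imp_continuous_on differentiable_imp_continuous_within)
  have cD: "continuous_on X (\<lambda>z. frechet_derivative \<phi> (at z) e)" for X e
    using test_functions_continuous_frechet_derivative[OF \<phi>] continuous_on_subset by blast
  have U': "U \<in> sets lebesgue" using U by simp
  have i1: "integrable (lebesgue_on U) (\<lambda>x. v x *\<^sub>R grad \<phi> x)"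
    using cv cD by (intro integrable_lebesgue_on_continuous_compact_support(1)[OF _ K _ U'])
      (auto intro!: continuous_intros simp: grad_def D0 vec_eq_iff)
  have i2: "integrable (lebesgue_on U) (\<lambda>x. \<phi> x *\<^sub>R g x)"
    using c\<phi> cg by (intro integrable_lebesgue_on_continuous_compact_support(1)[OF _ K _ U'])
      (auto intro!: continuous_intros simp: \<phi>0)
  show "(LINT x|lebesgue_on U. v x *\<^sub>R grad \<phi> x) = - (LINT x|lebesgue_on U. \<phi> x *\<^sub>R g x)"
  proof (rule vec_eq_iff[THEN iffD2], rule allI)
    fix i
    have "(LINT x|lebesgue_on U. v x *\<^sub>R grad \<phi> x) $ i = (LINT x|lebesgue_on U. (v x *\<^sub>R grad \<phi> x) $ i)"
      using integral_bounded_linear[OF bounded_linear_vec_nth i1, of i] by simp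
    also have "\<dots> = (LINT x|lebesgue_on U. v x * frechet_derivative \<phi> (at x) (axis i 1))"
      by (simp add: grad_def)
    also have "\<dots> = - (LINT x|lebesgue_on U. \<phi> x * (g x $ i))"
    proof (rule integration_by_parts_test_function(3)[OF \<phi> U])
      show "((\<lambda>s. v (z + s *\<^sub>R axis i 1)) has_real_derivative g z $ i) (at 0)" for z
        using has_derivative_imp_line_derivative[OF v[of z], of "axis i 1"] by (simp add: inner_axis)
    qed (use cv cg in \<open>auto intro!: continuous_intros\<close>)
    also have "\<dots> = - (LINT x|lebesgue_on U. (\<phi> x *\<^sub>R g x) $ i)" by simp
    also have "\<dots> = (- (LINT x|lebesgue_on U. \<phi> x *\<^sub>R g x)) $ i"
      using integral_bounded_linear[OF bounded_linear_vec_nth i2, of i] by simp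
    finally show "(LINT x|lebesgue_on U. v x *\<^sub>R grad \<phi> x) $ i = (- (LINT x|lebesgue_on U. \<phi> x *\<^sub>R g x)) $ i" .
  qed
qed

text \<open>Expanding the square turns the squared norm of the time slice t into a quadratic polynomial in
  \<open>A t\<close>, whose coefficients are integrals that do not depend on t.\<close>

lemma C_L2_separable:
  fixes N :: "real^'n \<Rightarrow> real"
  assumes N: "continuous_on UNIV N" and A: "continuous_on {t1..t2} A"
    and U: "open U" "bounded U"
  shows "(\<lambda>z. ereal (b - A (snd z) * N (fst z))) \<in> C_L2 U t1 t2"
proof -
  have cN: "continuous_on X N" for X using N continuous_on_subset by blast
  have int: "integrable (lebesgue_on U) f" if "continuous_on UNIV f" for f :: "real^'n \<Rightarrow> real"
    using U that by (intro integrable_lebesgue_on_subset_compact[where K="closure U"])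
      (auto simp: compact_closure closure_subset intro: continuous_on_subset)
  define I1 I2 where "I1 = (LINT x|lebesgue_on U. N x)" and "I2 = (LINT x|lebesgue_on U. (N x)^2)"
  have eq: "(\<integral>\<^sup>+x. (e2ennreal \<bar>ereal (b - A t * N x)\<bar>)\<^sup>2 \<partial>lebesgue_on U)
    = ennreal (b^2 * (LINT x|lebesgue_on U. 1) - 2 * b * A t * I1 + (A t)^2 * I2)" for t
  proof -
    have "(\<integral>\<^sup>+x. (e2ennreal \<bar>ereal (b - A t * N x)\<bar>)\<^sup>2 \<partial>lebesgue_on U)
        = (\<integral>\<^sup>+x. ennreal ((b - A t * N x)\<^sup>2) \<partial>lebesgue_on U)"
      by (simp add: ennreal_power)
    also have "\<dots> = ennreal (LINT x|lebesgue_on U. (b - A t * N x)\<^sup>2)"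
      using cN by (intro nn_integral_eq_integral int) (auto intro!: continuous_intros)
    also have "(LINT x|lebesgue_on U. (b - A t * N x)\<^sup>2)
        = (LINT x|lebesgue_on U. b^2 * 1 - 2 * b * A t * N x + (A t)^2 * (N x)^2)"
      by (simp add: power2_eq_square algebra_simps)
    also have "\<dots> = b^2 * (LINT x|lebesgue_on U. 1) - 2 * b * A t * I1 + (A t)^2 * I2"
    proof -
      have i: "integrable (lebesgue_on U) (\<lambda>x. b^2 * 1)" "integrable (lebesgue_on U) (\<lambda>x. 2 * b * A t * N x)"
        "integrable (lebesgue_on U) (\<lambda>x. (A t)^2 * (N x)^2)"
        using cN by (auto intro!: int continuous_intros)
      show ?thesis unfolding I1_def I2_def
        by (subst Bochner_Integration.integral_add, use i in simp, use i in simp,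
            subst Bochner_Integration.integral_diff, use i in simp, use i in simp)
           (simp only: integral_mult_right_zero)
    qed
    finally show ?thesis .
  qed
  show ?thesis unfolding C_L2_def
  proof (intro CollectI conjI ballI)
    fix t assume "t \<in> {t1..t2}"
    have "(\<lambda>x. b - A t * N x) \<in> borel_measurable (lebesgue_on U)"
      using cN U by (intro continuous_imp_measurable_on_sets_lebesgue) (auto intro!: continuous_intros)
    then show "(\<lambda>x. ereal (b - A (snd (x, t)) * N (fst (x, t)))) \<in> borel_measurable (lebesgue_on U)"
      by simp
    show "(\<integral>\<^sup>+x. (e2ennreal \<bar>ereal (b - A (snd (x, t)) * N (fst (x, t)))\<bar>)\<^sup>2 \<partial>lebesgue_on U) < \<infinity>"
      unfolding fst_conv snd_conv eq by simp
  next
    show "continuous_on {t1..t2} (\<lambda>t. \<integral>\<^sup>+x. (e2ennreal \<bar>ereal (b - A (snd (x, t)) * N (fst (x, t)))\<bar>)\<^sup>2 \<partial>lebesgue_on U)"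
      unfolding fst_conv snd_conv eq using A by (intro continuous_on_ennreal continuous_intros)
  qed
qed

lemma lebesgue_on_empty:
  fixes f :: "'a::euclidean_space \<Rightarrow> 'b::euclidean_space"
  shows borel_measurable_lebesgue_on_empty: "h \<in> borel_measurable (lebesgue_on ({}::'a set))"
    and integrable_lebesgue_on_empty: "integrable (lebesgue_on {}) f"
    and integral_lebesgue_on_empty: "(LINT x|lebesgue_on {}. f x) = 0"
    and nn_integral_lebesgue_on_empty: "(\<integral>\<^sup>+x. k x \<partial>lebesgue_on ({}::'a set)) = 0"
  by (simp_all add: measurable_def integrable_restrict_space integral_restrict_space
      nn_integral_restrict_space)

text \<open>An empty base set makes every cylinder compactly contained, whatever its time interval is, so weak
  solutions have to be tested on these degenerate cylinders beyond the blow-up time as well.\<close>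

lemma function_spaces_empty:
  fixes u :: "(real^'n) \<times> real \<Rightarrow> real"
  shows "(\<lambda>z. ereal (u z)) \<in> C_L2 {} t1 t2"
    and "Lp_W1p_with_gradient p {} t1 t2 (\<lambda>z. ereal (u z)) G"
proof -
  note e = lebesgue_on_empty
  have w: "weak_gradient {} v g" for v and g :: "real^'n \<Rightarrow> real^'n"
    by (simp add: weak_gradient_def locally_integrable_def e)
  show 1: "(\<lambda>z. ereal (u z)) \<in> C_L2 {} t1 t2"
    unfolding C_L2_def e by (simp add: e del: borel_measurable_ereal_iff)
  have 2: "(\<lambda>x. ereal (u (x, t))) \<in> W1p p {}" for t
    unfolding W1p_def Lp_space_def using w 
    by (auto intro!: AE_I2 simp: e)
  show "Lp_W1p_with_gradient p {} t1 t2 (\<lambda>z. ereal (u z)) G"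
    unfolding Lp_W1p_with_gradient_def Sigma_empty1
    using 2 w by (intro conjI e AE_I2) simp_all
qed

section \<open>The focusing solution\<close>

text \<open>Write y = x - c. The gradient of the function is \<open>- q A |y|^(q-2) y\<close>, and since
  \<open>(q - 1) (p - 2) = 2\<close>, the flux is \<open>- (q A)^(p-1) |y|^q y\<close>, whose divergence is
  \<open>- (n + q) (q A)^(p-1) |y|^q\<close>. The equation thus reduces to the ordinary differential equation
  for A. The flux and its divergence are continuous at y = 0, so the weak formulation follows from
  integration by parts, one spatial coordinate at a time and once in time.\<close>

lemma p_parabolic_radial_power:
  fixes c :: "real^'n" and A :: "real \<Rightarrow> real"
  assumes p: "p > 2" and q: "q = p / (p - 2)"
    and A: "\<And>t. t < T \<Longrightarrow> A t > 0"
    and ode: "\<And>t. t < T \<Longrightarrow>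
      (A has_real_derivative (real CARD('n) + q) * (q * A t) powr (p - 1)) (at t)"
    and S: "S \<subseteq> UNIV \<times> {..<T}"
  shows "p_parabolic p S (\<lambda>z. b - A (snd z) * norm (fst z - c) powr q)"
proof -
  define N where "N x = norm (x - c) powr q" for x
  define W where "W x = norm (x - c) powr (q - 2) *\<^sub>R (x - c)" for x
  define h where "h z = b - A (snd z) * N (fst z)" for z
  define G where "G z = (- (q * A (snd z))) *\<^sub>R W (fst z)" for z
  define B where "B t = (q * A t) powr (p - 1)" for t
  have q1: "q > 1" using p by (simp add: q field_simps)
  have cW: "continuous_on X W" for X
  proof -
    have "continuous_on UNIV W"
      using continuous_on_norm_powr_scaleR[of "q - 1" c] q1 by (simp add: W_def diff_diff_eq)
    then show ?thesis using continuous_on_subset by blast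
  qed
  have dN: "(N has_derivative (\<lambda>k. q * (W x \<bullet> k))) (at x)" for x
    using has_derivative_norm_powr[OF q1, of c x] unfolding N_def W_def by (simp add: mult.assoc)
  have cN: "continuous_on X N" for X
    using dN by (meson continuous_at_imp_continuous_on has_derivative_continuous)
  have cA: "continuous_on X A" if "X \<subseteq> {..<T}" for X
    using ode that by (intro continuous_at_imp_continuous_on ballI) (auto intro: DERIV_isCont)
  have cAs: "continuous_on X (\<lambda>z. A (snd z))" if "X \<subseteq> UNIV \<times> {..<T}" for X :: "((real^'n) \<times> real) set"
    using that by (intro continuous_on_compose2[OF cA[OF subset_refl]] continuous_intros) auto
  have cBs: "continuous_on X (\<lambda>z. B (snd z))" if "X \<subseteq> UNIV \<times> {..<T}" for X :: "((real^'n) \<times> real) set"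
    unfolding B_def using that A q1
    by (intro continuous_intros cAs) (auto dest!: subsetD, fastforce+)
  have cNs: "continuous_on X (\<lambda>z. N (fst z))" for X :: "((real^'n) \<times> real) set"
    by (intro continuous_on_compose2[OF cN[of UNIV]] continuous_intros) auto
  have cWs: "continuous_on X (\<lambda>z. W (fst z))" for X :: "((real^'n) \<times> real) set"
    by (intro continuous_on_compose2[OF cW[of UNIV]] continuous_intros) auto
  have ch: "continuous_on X h" if "X \<subseteq> UNIV \<times> {..<T}" for X
    unfolding h_def by (intro continuous_intros cAs cNs that)
  have cG: "continuous_on X G" if "X \<subseteq> UNIV \<times> {..<T}" for X
    unfolding G_def by (intro continuous_intros cAs cWs that)
  \<comment> \<open>The exponent q is chosen to make the next identity hold: it turns the flux
    into a multiple of N(x) (x - c).\<close>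
  have flux: "norm (G z) powr (p - 2) *\<^sub>R G z = (- (B (snd z) * N (fst z))) *\<^sub>R (fst z - c)"
    if "snd z < T" for z
  proof (cases "fst z = c")
    case False
    define r where "r = norm (fst z - c)"
    have r: "r > 0" using False by (simp add: r_def)
    have a: "q * A (snd z) > 0" using A[OF that] q1 by simp
    have "norm (W (fst z)) = r powr (q - 1)"
      using r powr_add[of r "q - 2" 1] by (simp add: W_def r_def)
    then have "norm (G z) = q * A (snd z) * r powr (q - 1)"
      using A[OF that] q1 by (simp add: G_def abs_mult)
    then have "norm (G z) powr (p - 2) = (q * A (snd z)) powr (p - 2) * r powr ((q - 1) * (p - 2))"
      using a r by (simp add: powr_mult powr_powr)
    also have "(q - 1) * (p - 2) = 2" using p by (simp add: q field_simps)
    finally have n: "norm (G z) powr (p - 2) = (q * A (snd z)) powr (p - 2) * r powr 2" .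
    have b: "(q * A (snd z)) powr (p - 2) * (q * A (snd z)) = B (snd z)"
      unfolding B_def using a powr_add[of "q * A (snd z)" "p - 2" 1] by simp
    have d: "r powr 2 * r powr (q - 2) = N (fst z)"
      using r powr_add[of r 2 "q - 2"] by (simp add: N_def r_def)
    have "norm (G z) powr (p - 2) *\<^sub>R G z =
      (- (((q * A (snd z)) powr (p - 2) * (q * A (snd z))) * (r powr 2 * r powr (q - 2)))) *\<^sub>R (fst z - c)"
      unfolding n unfolding G_def W_def r_def[symmetric] by (simp add: mult_ac)
    then show ?thesis unfolding b d .
  qed (simp add: G_def W_def)
  have main: "h' \<in> C_L2 U t1 t2 \<and>
        (\<exists>G. Lp_W1p_with_gradient p U t1 t2 h' G \<and>
             (\<forall>\<phi>\<in>test_functions (U \<times> {t1<..<t2}).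
                (LINT (x, t)|lebesgue_on (U \<times> {t1<..<t2}).
                   (norm (G (x, t)) powr (p - 2) *\<^sub>R G (x, t)) \<bullet> grad (\<lambda>y. \<phi> (y, t)) x)
                - (LINT (x, t)|lebesgue_on (U \<times> {t1<..<t2}).
                     real_of_ereal (h' (x, t)) * deriv (\<lambda>s. \<phi> (x, s)) t) = 0))"
    if h': "h' = (\<lambda>z. ereal (h z))" and U: "open U" and t12: "t1 < t2"
      and cc: "U \<times> {t1<..<t2} \<Subset> S" for h' U t1 t2
  proof (cases "U = {}")
    case True
    show ?thesis unfolding True Sigma_empty1 h'
      using function_spaces_empty[where 'n='n]
      by (auto intro!: exI[of _ G] simp: integral_lebesgue_on_empty case_prod_unfold)
  next
    case False
    define V where "V = U \<times> {t1<..<t2}"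
    define K where "K = closure U \<times> {t1..t2}"
    have clV: "closure V = K" unfolding V_def K_def closure_Times using t12 by simp
    have K: "compact K" "K \<subseteq> S" using cc unfolding compactly_contained_def V_def[symmetric] clV by auto
    have KT: "K \<subseteq> UNIV \<times> {..<T}" using K S by auto
    have t2: "t2 < T"
    proof -
      obtain x where "x \<in> U" using False by blast
      then have "(x, t2) \<in> K" using t12 closure_subset[of U] by (auto simp: K_def)
      then show ?thesis using KT by auto
    qed
    have cU: "compact (closure U)"
    proof -
      have "fst ` K = closure U" unfolding K_def using t12 by auto
      then show ?thesis using compact_continuous_image[OF continuous_on_fst[OF continuous_on_id] K(1)] by simp
    qed
    have bU: "bounded U" using cU bounded_closure_image bounded_subset closure_subset compact_imp_bounded by metis
    have V: "open V" unfolding V_def using U by (intro open_Times) auto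
    have VK: "V \<subseteq> K" using clV closure_subset by blast
    have VT: "V \<subseteq> UNIV \<times> {..<T}" using VK KT by blast
    have Vm: "V \<in> sets lebesgue" "U \<in> sets lebesgue" using V U by auto
    have intV: "integrable (lebesgue_on V) f" if "continuous_on K f" for f :: "_ \<Rightarrow> real"
      using that K(1) VK Vm(1) by (rule integrable_lebesgue_on_subset_compact)
    have intU: "integrable (lebesgue_on U) f" if "continuous_on UNIV f" for f :: "_ \<Rightarrow> real"
      using cU closure_subset Vm(2) that
      by (intro integrable_lebesgue_on_subset_compact[where K="closure U"]) (auto intro: continuous_on_subset)
    have 1: "h' \<in> C_L2 U t1 t2"
    proof -
      have "{t1..t2} \<subseteq> {..<T}" using t2 by auto
      then show ?thesis unfolding h' h_def using U bU cA cN by (intro C_L2_separable)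
    qed
    have wg: "weak_gradient U (\<lambda>x. h (x, t)) (\<lambda>x. G (x, t))" for t
    proof (rule weak_gradient_continuously_differentiable[OF _ _ U])
      show "((\<lambda>x. h (x, t)) has_derivative (\<lambda>k. G (x, t) \<bullet> k)) (at x)" for x
        unfolding h_def G_def by (auto intro!: derivative_eq_intros dN)
      show "continuous_on UNIV (\<lambda>x. G (x, t))"
        unfolding G_def by (auto intro!: continuous_intros cW)
    qed
    have cp: "continuous_on X (\<lambda>x. norm (f x) powr p)" if "continuous_on X f"
      for X and f :: "'z::euclidean_space \<Rightarrow> 'w::euclidean_space"
      using that p by (intro continuous_on_powr' continuous_intros) auto
    have ct: "continuous_on UNIV (\<lambda>x. h (x, t))" "continuous_on UNIV (\<lambda>x. G (x, t))" for t
      unfolding h_def G_def by (auto intro!: continuous_intros cW cN)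
    have W1p: "(\<lambda>x. h' (x, t)) \<in> W1p p U" for t
    proof -
      have "(\<lambda>x. h (x, t)) \<in> Lp_space p U" "(\<lambda>x. G (x, t)) \<in> Lp_space p U"
        unfolding Lp_space_def
        using ct[of t] Vm cp[OF ct(1), of t] cp[OF ct(2), of t]
        by (auto intro!: intU continuous_imp_measurable_on_sets_lebesgue intro: continuous_on_subset)
      then show ?thesis unfolding W1p_def h' using wg[of t] by auto
    qed
    have 2: "Lp_W1p_with_gradient p U t1 t2 h' G"
      unfolding Lp_W1p_with_gradient_def V_def[symmetric]
    proof (intro conjI)
      have "h \<in> borel_measurable (lebesgue_on V)"
        using ch[OF VT] Vm by (intro continuous_imp_measurable_on_sets_lebesgue)
      then show "h' \<in> borel_measurable (lebesgue_on V)" unfolding h' by simp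
      show "G \<in> borel_measurable (lebesgue_on V)"
        using cG[OF VT] Vm by (intro continuous_imp_measurable_on_sets_lebesgue)
      show "AE t in lebesgue_on {t1<..<t2}. (\<lambda>x. h' (x, t)) \<in> W1p p U \<and>
          weak_gradient U (\<lambda>x. real_of_ereal (h' (x, t))) (\<lambda>x. G (x, t))"
        using W1p wg by (intro AE_I2) (auto simp: h')
      show "integrable (lebesgue_on V) (\<lambda>z. \<bar>real_of_ereal (h' z)\<bar> powr p + norm (G z) powr p)"
        unfolding h' using cp[OF ch[OF KT]] cp[OF cG[OF KT]]
        by (intro intV continuous_on_add) simp_all
    qed
    have 3: "(LINT (x, t)|lebesgue_on V. (norm (G (x, t)) powr (p - 2) *\<^sub>R G (x, t)) \<bullet> grad (\<lambda>y. \<phi> (y, t)) x)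
            - (LINT (x, t)|lebesgue_on V. real_of_ereal (h' (x, t)) * deriv (\<lambda>s. \<phi> (x, s)) t) = 0"
      if \<phi>: "\<phi> \<in> test_functions V" for \<phi>
    proof -
      note diff = test_functions_differentiable[OF \<phi>, unfolded frechet_derivative_works]
      define D where "D i z = frechet_derivative \<phi> (at z) (axis i 1, 0)" for i z
      define Dt where "Dt z = frechet_derivative \<phi> (at z) (0, 1)" for z
      have gr: "grad (\<lambda>y. \<phi> (y, t)) x $ i = D i (x, t)" for x t i
      proof -
        have "((\<lambda>y. \<phi> (y, t)) has_derivative (\<lambda>k. frechet_derivative \<phi> (at (x, t)) (k, 0))) (at x)"
          by (rule has_derivative_compose[where g=\<phi> and f="\<lambda>y. (y, t)"])
            (auto intro!: derivative_eq_intros diff)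
        then show ?thesis by (simp add: grad_def D_def frechet_derivative_at[symmetric])
      qed
      have dt: "deriv (\<lambda>s. \<phi> (x, s)) t = Dt (x, t)" for x t
      proof -
        have "((\<lambda>s. \<phi> ((x, t) + s *\<^sub>R (0, 1))) has_real_derivative Dt (x, t)) (at 0)"
          unfolding Dt_def by (rule has_derivative_imp_line_derivative[OF diff])
        then have "((\<lambda>s. \<phi> (x, t + s)) has_real_derivative Dt (x, t)) (at 0)" by simp
        then have "((\<lambda>s. \<phi> (x, s)) has_real_derivative Dt (x, t)) (at t)"
          using DERIV_shift[of "\<lambda>s. \<phi> (x, s)" "Dt (x, t)" 0 t] by (simp add: add.commute)
        then show ?thesis by (rule DERIV_imp_deriv)
      qed
      define F where "F i z = - (B (snd z) * N (fst z)) * (fst z - c) $ i" for i z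
      define F' where "F' i z = - B (snd z) * (N (fst z) + q * (W (fst z) $ i) * (fst z - c) $ i)" for i z
      have ibp: "integrable (lebesgue_on V) (\<lambda>z. F i z * D i z)"
          "integrable (lebesgue_on V) (\<lambda>z. \<phi> z * F' i z)"
          "(LINT z|lebesgue_on V. F i z * D i z) = - (LINT z|lebesgue_on V. \<phi> z * F' i z)" for i
      proof -
        have a: "((\<lambda>s. F i (z + s *\<^sub>R (axis i 1, 0))) has_real_derivative F' i z) (at 0)" if "z \<in> V" for z
        proof -
          have "((\<lambda>x. - (B (snd z) * N x) * (x - c) $ i) has_derivative
             (\<lambda>k. - (B (snd z) * (q * (W (fst z) \<bullet> k))) * (fst z - c) $ i - (B (snd z) * N (fst z)) * k $ i)) (at (fst z))"
            by (auto intro!: derivative_eq_intros dN bounded_linear_imp_has_derivative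
                simp: fun_eq_iff algebra_simps)
          from has_derivative_imp_line_derivative[OF this, of "axis i 1"]
          show ?thesis by (simp add: F_def F'_def inner_axis algebra_simps)
        qed
        have b: "continuous_on V (F i)" "continuous_on V (F' i)"
          unfolding F_def F'_def by (intro continuous_intros cBs[OF VT] cNs cWs)+
        show "integrable (lebesgue_on V) (\<lambda>z. F i z * D i z)"
          "integrable (lebesgue_on V) (\<lambda>z. \<phi> z * F' i z)"
          "(LINT z|lebesgue_on V. F i z * D i z) = - (LINT z|lebesgue_on V. \<phi> z * F' i z)"
          unfolding D_def by (rule integration_by_parts_test_function[OF \<phi> V a b], assumption)+
      qed
      have sumF': "(\<Sum>i\<in>UNIV. F' i z) = - ((real CARD('n) + q) * B (snd z) * N (fst z))" for z
      proof -
        have "(\<Sum>i\<in>UNIV. W (fst z) $ i * (fst z - c) $ i) = W (fst z) \<bullet> (fst z - c)"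
          by (simp add: inner_vec_def)
        also have "\<dots> = N (fst z)"
          using powr_add[of "norm (fst z - c)" "q - 2" 2]
          by (cases "fst z = c") (auto simp: W_def N_def dot_square_norm)
        finally have "(\<Sum>i\<in>UNIV. W (fst z) $ i * (fst z - c) $ i) = N (fst z)" .
        moreover have "(\<Sum>i\<in>UNIV. F' i z) =
            - B (snd z) * (real CARD('n) * N (fst z) + q * (\<Sum>i\<in>UNIV. W (fst z) $ i * (fst z - c) $ i))"
          unfolding F'_def
          by (simp only: sum_distrib_left[symmetric] sum.distrib mult.assoc) simp
        ultimately show ?thesis by (simp add: algebra_simps)
      qed
      define H' where "H' z = - ((real CARD('n) + q) * B (snd z) * N (fst z))" for z
      have time: "(LINT z|lebesgue_on V. h z * Dt z) = - (LINT z|lebesgue_on V. \<phi> z * H' z)"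
        unfolding Dt_def
      proof (rule integration_by_parts_test_function(3)[OF \<phi> V])
        fix z assume "z \<in> V"
        then have z: "snd z < T" using VT by auto
        have "((\<lambda>t. h (fst z, t)) has_real_derivative H' z) (at (snd z))"
          unfolding h_def H'_def B_def by (auto intro!: derivative_eq_intros ode[OF z])
        then have "((\<lambda>s. h (fst z, s + snd z)) has_real_derivative H' z) (at 0)"
          using DERIV_shift[of "\<lambda>t. h (fst z, t)" "H' z" 0 "snd z"] by simp
        then show "((\<lambda>s. h (z + s *\<^sub>R (0, 1))) has_real_derivative H' z) (at 0)"
          by (simp add: h_def add.commute)
        next
        show "continuous_on V h" by (rule ch[OF VT])
        show "continuous_on V H'" unfolding H'_def by (intro continuous_intros cBs[OF VT] cNs)
      qed
      have "(LINT (x, t)|lebesgue_on V. (norm (G (x, t)) powr (p - 2) *\<^sub>R G (x, t)) \<bullet> grad (\<lambda>y. \<phi> (y, t)) x)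
          = (LINT z|lebesgue_on V. (\<Sum>i\<in>UNIV. F i z * D i z))"
      proof (rule Bochner_Integration.integral_cong[OF refl])
        fix z assume "z \<in> space (lebesgue_on V)"
        moreover obtain x t where z: "z = (x, t)" by force
        ultimately have "t < T" using VT by auto
        then have fl: "norm (G (x, t)) powr (p - 2) *\<^sub>R G (x, t) = (- (B t * N x)) *\<^sub>R (x - c)"
          using flux[of "(x, t)"] by simp
        show "(case z of (x, t) \<Rightarrow> (norm (G (x, t)) powr (p - 2) *\<^sub>R G (x, t)) \<bullet> grad (\<lambda>y. \<phi> (y, t)) x)
            = (\<Sum>i\<in>UNIV. F i z * D i z)"
          unfolding z prod.case fl by (simp add: inner_vec_def gr F_def)
      qed
      also have "\<dots> = (\<Sum>i\<in>UNIV. - (LINT z|lebesgue_on V. \<phi> z * F' i z))"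
        using ibp by simp
      also have "\<dots> = - (LINT z|lebesgue_on V. (\<Sum>i\<in>UNIV. \<phi> z * F' i z))"
        using ibp by (simp add: sum_negf)
      also have "(LINT z|lebesgue_on V. (\<Sum>i\<in>UNIV. \<phi> z * F' i z)) = (LINT z|lebesgue_on V. \<phi> z * H' z)"
        by (simp add: sum_distrib_left[symmetric] sumF' H'_def)
      also have "- \<dots> = (LINT z|lebesgue_on V. h z * Dt z)" using time by simp
      also have "\<dots> = (LINT (x, t)|lebesgue_on V. real_of_ereal (h' (x, t)) * deriv (\<lambda>s. \<phi> (x, s)) t)"
        by (simp add: h' dt case_prod_unfold)
      finally show ?thesis by simp
    qed
    show ?thesis using 1 2 3 unfolding V_def by blast
  qed
  show ?thesis
    unfolding p_parabolic_def weak_solution_def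
    using ch[OF S] main[OF refl] unfolding h_def N_def by blast
qed

text \<open>The value for which \<open>A t = focusing_constant p n * (T - t) powr (- 1 / (p - 2))\<close> satisfies
  \<open>A' = (n + q) (q A)^(p-1)\<close> with q = p / (p - 2): substituting gives
  \<open>K^(p-2) (n + q) q^(p-1) (p - 2) = 1\<close>.\<close>

definition focusing_constant :: "real \<Rightarrow> real \<Rightarrow> real" where
  "focusing_constant p n =
     ((n + p / (p - 2)) * (p / (p - 2)) powr (p - 1) * (p - 2)) powr (- 1 / (p - 2))"

text \<open>A solution that equals b on the axis x = c and decreases to minus infinity everywhere else as t
  increases to T. Its superlevel sets are paraboloids: \<open>focusing p b c T (x, t) \<ge> b - a\<close> holds iff
  \<open>|x - c|^p\<close> is at most a constant multiple of \<open>a^(p-2) (T - t)\<close>.\<close>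

definition focusing :: "real \<Rightarrow> real \<Rightarrow> real^'n \<Rightarrow> real \<Rightarrow> (real^'n) \<times> real \<Rightarrow> real" where
  "focusing p b c T z =
     b - focusing_constant p (real CARD('n)) * (T - snd z) powr (- 1 / (p - 2))
           * norm (fst z - c) powr (p / (p - 2))"

lemma focusing_constant_pos: "p > 2 \<Longrightarrow> n \<ge> 0 \<Longrightarrow> focusing_constant p n > 0"
  by (auto simp: focusing_constant_def add_nonneg_eq_0_iff)

lemma p_parabolic_focusing:
  fixes c :: "real^'n"
  assumes p: "p > 2" and S: "S \<subseteq> UNIV \<times> {..<T}"
  shows "p_parabolic p S (focusing p b c T)"
proof -
  define n where "n = real CARD('n)"
  define q where "q = p / (p - 2)"
  define K where "K = focusing_constant p n"
  define A where "A t = K * (T - t) powr (- 1 / (p - 2))" for t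
  have q: "q > 0" using p by (simp add: q_def)
  have K: "K > 0" unfolding K_def using p by (intro focusing_constant_pos) (auto simp: n_def)
  define M where "M = (n + q) * q powr (p - 1) * (p - 2)"
  have M: "M > 0" using p q by (simp add: M_def n_def add_nonneg_pos)
  have "K powr (p - 2) = M powr - 1"
    unfolding K_def focusing_constant_def q_def[symmetric] M_def[symmetric] using p
    by (simp add: powr_powr)
  then have KM: "K powr (p - 2) * M = 1" using M by (simp add: powr_minus)
  have Kp: "K powr (p - 1) = K powr (p - 2) * K" using K powr_add[of K "p - 2" 1] by simp
  show ?thesis
    unfolding focusing_def[abs_def] n_def[symmetric] q_def[symmetric] K_def[symmetric] A_def[symmetric]
  proof (rule p_parabolic_radial_power[OF p q_def _ _ S])
    fix t assume t: "t < T"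
    then show "A t > 0" using K by (simp add: A_def)
    define s where "s = T - t"
    have s: "s > 0" using t by (simp add: s_def)
    have "(q * A t) powr (p - 1) = q powr (p - 1) * (K powr (p - 1) * s powr (- 1 / (p - 2) * (p - 1)))"
      using q K s unfolding A_def s_def[symmetric] by (simp add: powr_mult powr_powr)
    then have "(n + q) * (q * A t) powr (p - 1) =
       (K powr (p - 2) * M) * K * s powr (- 1 / (p - 2) * (p - 1)) / (p - 2)"
      unfolding Kp M_def using p by (simp add: field_simps)
    also have "- 1 / (p - 2) * (p - 1) = - 1 / (p - 2) - 1" using p by (simp add: field_simps)
    finally have rhs: "(n + q) * (q * A t) powr (p - 1) = K * s powr (- 1 / (p - 2) - 1) / (p - 2)"
      using KM by simp
    have "((\<lambda>t. (T - t) powr (- 1 / (p - 2))) has_real_derivative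
        (- 1 / (p - 2)) * s powr (- 1 / (p - 2) - 1) * (- 1)) (at t)"
      using s unfolding s_def
      by (intro DERIV_chain2[where f="\<lambda>x. x powr (- 1 / (p - 2))"] has_real_derivative_powr)
        (auto intro!: derivative_eq_intros)
    from DERIV_cmult[OF this, of K]
    show "(A has_real_derivative (real CARD('n) + q) * (q * A t) powr (p - 1)) (at t)"
      unfolding n_def[symmetric] rhs unfolding A_def[abs_def] by simp
  qed
qed

lemma focusing_le: "p > 2 \<Longrightarrow> focusing p b c T z \<le> b"
  using focusing_constant_pos[of p "real CARD('a)"] by (simp add: focusing_def)

lemma focusing_center [simp]: "focusing p b c T (c, t) = b"
  by (simp add: focusing_def)

text \<open>The solution decreases both in time and in the distance to the axis.\<close>

lemma focusing_le_outside:
  fixes c :: "real^'n"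
  assumes p: "p > 2" and "0 \<le> r" "r \<le> norm (x - c)" "s \<le> t" "t < T"
  shows "focusing p b c T (x, t) \<le>
    b - focusing_constant p (real CARD('n)) * (T - s) powr (- 1 / (p - 2)) * r powr (p / (p - 2))"
proof -
  have K: "focusing_constant p (real CARD('n)) > 0" using p by (intro focusing_constant_pos) auto
  have "(T - s) powr (- 1 / (p - 2)) \<le> (T - t) powr (- 1 / (p - 2))"
    using p assms by (intro powr_mono2') auto
  moreover have "r powr (p / (p - 2)) \<le> norm (x - c) powr (p / (p - 2))"
    using p assms by (intro powr_mono2) auto
  ultimately show ?thesis using K unfolding focusing_def by (auto intro!: mult_mono)
qed

section \<open>Comparison on cubes\<close>

text \<open>Superparabolicity is a comparison on boxes with sides parallel to the axes, while the focusing
  solution is radial. A cube of half-side r lies between the balls of radii r and n r.\<close>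

definition cube :: "real^'n \<Rightarrow> real \<Rightarrow> (real^'n) set" where
  "cube c r = box (\<chi> i. c $ i - r) (\<chi> i. c $ i + r)"

definition closed_cube :: "real^'n \<Rightarrow> real \<Rightarrow> (real^'n) set" where
  "closed_cube c r = cbox (\<chi> i. c $ i - r) (\<chi> i. c $ i + r)"

lemma mem_cube: "x \<in> cube c r \<longleftrightarrow> (\<forall>i. \<bar>(x - c) $ i\<bar> < r)"
proof -
  have "(c $ i - r < x $ i \<and> x $ i < c $ i + r) = (\<bar>(x - c) $ i\<bar> < r)" for i by auto
  then show ?thesis by (simp add: cube_def mem_box_cart)
qed

lemma mem_closed_cube: "x \<in> closed_cube c r \<longleftrightarrow> (\<forall>i. \<bar>(x - c) $ i\<bar> \<le> r)"
proof -
  have "(c $ i - r \<le> x $ i \<and> x $ i \<le> c $ i + r) = (\<bar>(x - c) $ i\<bar> \<le> r)" for i by auto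
  then show ?thesis by (simp add: closed_cube_def mem_box_cart)
qed

lemma compact_closed_cube: "compact (closed_cube c r)"
  by (simp add: closed_cube_def compact_cbox)

lemma closure_cube: "r > 0 \<Longrightarrow> closure (cube c r) = closed_cube c r"
proof -
  assume "r > 0"
  then have "c \<in> cube c r" by (simp add: mem_cube)
  then show ?thesis unfolding cube_def closed_cube_def by (intro closure_box) auto
qed

lemma open_cube: "open (cube c r)"
  by (simp add: cube_def open_box)

lemma frontier_cube: "r > 0 \<Longrightarrow> frontier (cube c r) = closed_cube c r - cube c r"
  by (simp add: frontier_def closure_cube interior_open open_cube)

lemma norm_le_of_mem_closed_cube:
  fixes c :: "real^'n"
  assumes "x \<in> closed_cube c r"
  shows "norm (x - c) \<le> real CARD('n) * r"
proof -
  have "norm (x - c) \<le> (\<Sum>i\<in>UNIV. \<bar>(x - c) $ i\<bar>)" by (rule norm_le_l1_cart)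
  also have "\<dots> \<le> (\<Sum>i\<in>(UNIV::'n set). r)" using assms by (intro sum_mono) (simp add: mem_closed_cube)
  finally show ?thesis by simp
qed

lemma le_norm_of_notin_cube:
  assumes "x \<notin> cube c r"
  shows "r \<le> norm (x - c)"
proof -
  obtain i where "r \<le> \<bar>(x - c) $ i\<bar>" using assms by (auto simp: mem_cube not_less)
  also have "\<dots> \<le> norm (x - c)" by (rule component_le_norm_cart)
  finally show ?thesis .
qed

text \<open>The restriction t2 < T keeps the focusing solution continuous up to the top of the box. The lateral
  faces are described by \<open>r \<le> norm (x - c)\<close>, which is all that a radial function can use.\<close>

lemma superparabolic_ge_focusing:
  fixes c :: "real^'n"
  assumes p: "p > 2" and v: "p_superparabolic p \<Theta> v"
    and r: "r > 0" and t12: "t1 < t2" "t2 < T"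
    and sub: "closed_cube c r \<times> {t1..t2} \<subseteq> \<Theta>"
    and bottom: "\<And>x. x \<in> closed_cube c r \<Longrightarrow> ereal (focusing p b c T (x, t1)) \<le> v (x, t1)"
    and side: "\<And>x t. \<lbrakk>x \<in> closed_cube c r; r \<le> norm (x - c); t1 < t; t \<le> t2\<rbrakk> \<Longrightarrow>
      ereal (focusing p b c T (x, t)) \<le> v (x, t)"
    and x: "x \<in> cube c r" and t: "t1 < t" "t < t2"
  shows "ereal (focusing p b c T (x, t)) \<le> v (x, t)"
proof -
  let ?Q = "cube c r \<times> {t1<..<t2}"
  have cl: "closure ?Q = closed_cube c r \<times> {t1..t2}"
    using r t12 by (simp add: closure_Times closure_cube)
  have "?Q \<Subset> \<Theta>"
    unfolding compactly_contained_def cl using sub by (auto intro: compact_Times compact_closed_cube)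
  moreover have "p_parabolic p ?Q (focusing p b c T)"
    using p t12 by (intro p_parabolic_focusing) auto
  moreover have "continuous_on (closure ?Q) (focusing p b c T)"
  proof -
    have "p_parabolic p (closure ?Q) (focusing p b c T)"
      unfolding cl using p t12 by (intro p_parabolic_focusing) auto
    then show ?thesis by (simp add: p_parabolic_def)
  qed
  moreover have "\<forall>z\<in>parabolic_boundary (cube c r) t1 t2. ereal (focusing p b c T z) \<le> v z"
  proof
    fix z assume "z \<in> parabolic_boundary (cube c r) t1 t2"
    then consider "fst z \<in> closed_cube c r" "snd z = t1"
      | "fst z \<in> closed_cube c r" "fst z \<notin> cube c r" "t1 < snd z" "snd z \<le> t2"
      unfolding parabolic_boundary_def closure_cube[OF r] frontier_cube[OF r] by auto
    then show "ereal (focusing p b c T z) \<le> v z"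
    proof cases
      case 1
      then show ?thesis using bottom[of "fst z"] by (metis prod.collapse)
    next
      case 2
      then show ?thesis using side[of "fst z" "snd z"] le_norm_of_notin_cube by auto
    qed
  qed
  ultimately have "\<forall>z\<in>?Q. ereal (focusing p b c T z) \<le> v z"
  proof -
    have "\<forall>a b t1 t2 h. (\<forall>i. a $ i < b $ i) \<and> t1 < t2 \<and> box a b \<times> {t1<..<t2} \<Subset> \<Theta> \<and>
        p_parabolic p (box a b \<times> {t1<..<t2}) h \<and> continuous_on (closure (box a b \<times> {t1<..<t2})) h \<and>
        (\<forall>z\<in>parabolic_boundary (box a b) t1 t2. ereal (h z) \<le> v z) \<longrightarrow>
        (\<forall>z\<in>box a b \<times> {t1<..<t2}. ereal (h z) \<le> v z)"
      using v unfolding p_superparabolic_def by (elim conjE)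
    note this[rule_format, of "\<chi> i. c $ i - r" "\<chi> i. c $ i + r" t1 t2 "focusing p b c T", folded cube_def]
    moreover have "(\<chi> i. c $ i - r) $ i < (\<chi> i. c $ i + r) $ i" for i using r by simp
    moreover assume "?Q \<Subset> \<Theta>" "p_parabolic p ?Q (focusing p b c T)"
      "continuous_on (closure ?Q) (focusing p b c T)"
      "\<forall>z\<in>parabolic_boundary (cube c r) t1 t2. ereal (focusing p b c T z) \<le> v z"
    ultimately show ?thesis using t12(1) by blast
  qed
  then show ?thesis using x t by auto
qed

section \<open>A minimum principle for superparabolic functions\<close>

text \<open>If no minimum existed, every z in K would have a neighbourhood on which u exceeds the value at some
  other point \<open>f z\<close> of K. Among the finitely many neighbourhoods that cover K, choose one for which
  \<open>u (f z)\<close> is least; the point \<open>f z\<close> itself is then not covered.\<close>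

lemma lower_semicontinuous_attains_inf:
  fixes u :: "'a::topological_space \<Rightarrow> ereal"
  assumes K: "compact K" "K \<noteq> {}"
    and lsc: "\<And>z y. z \<in> K \<Longrightarrow> y < u z \<Longrightarrow> eventually (\<lambda>w. y < u w) (at z within K)"
  obtains z where "z \<in> K" "\<And>w. w \<in> K \<Longrightarrow> u z \<le> u w"
proof (rule ccontr)
  assume "\<not> thesis"
  with that have "\<forall>z\<in>K. \<exists>w\<in>K. u w < u z" by (meson not_less)
  then obtain f where f: "\<And>z. z \<in> K \<Longrightarrow> f z \<in> K \<and> u (f z) < u z" by metis
  have "\<exists>X. open X \<and> z \<in> X \<and> (\<forall>w\<in>X \<inter> K. u (f z) < u w)" if z: "z \<in> K" for z
    using lsc[OF z, of "u (f z)"] f[OF z] unfolding eventually_at_topological by (metis IntE)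
  then obtain O' where O': "\<And>z. z \<in> K \<Longrightarrow> open (O' z) \<and> z \<in> O' z \<and> (\<forall>w\<in>O' z \<inter> K. u (f z) < u w)"
    by metis
  have "\<And>z. z \<in> K \<Longrightarrow> open (O' z)" "K \<subseteq> (\<Union>z\<in>K. O' z)" using O' by auto
  from compactE_image[OF K(1) this]
  obtain D where D: "D \<subseteq> K" "finite D" "K \<subseteq> (\<Union>z\<in>D. O' z)" by metis
  have "D \<noteq> {}" using D K by auto
  define m where "m = Min ((u \<circ> f) ` D)"
  have "m \<in> (u \<circ> f) ` D" using D \<open>D \<noteq> {}\<close> by (auto simp: m_def)
  then obtain z where z: "z \<in> D" "m = u (f z)" by auto
  have fz: "f z \<in> K" using f[of z] z D(1) by blast
  then obtain z' where z': "z' \<in> D" "f z \<in> O' z'" using D(3) by blast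
  then have "u (f z') < m" using O'[of z'] D(1) z fz by blast
  moreover have "m \<le> u (f z')" unfolding m_def using D z' by auto
  ultimately show False by simp
qed

lemma lsc_onD:
  "lsc_on S u \<Longrightarrow> z \<in> S \<Longrightarrow> y < u z \<Longrightarrow> eventually (\<lambda>w. y < u w) (at z within S)"
  unfolding lsc_on_def by (auto intro: less_LiminfD less_le_trans)

text \<open>Lower semicontinuity of \<open>u (x, t) + t\<close>, in a form that serves interior points, with
  \<open>L = u \<xi>\<close>, as well as boundary points, where L is a lower bound for the lower limit.\<close>

lemma eventually_less_add_time:
  fixes u :: "(real^'n) \<times> real \<Rightarrow> ereal"
  assumes L: "L \<le> Liminf (at \<xi> within S) u" and y: "y < L + ereal (snd \<xi>)"
  shows "eventually (\<lambda>z. y < u z + ereal (snd z)) (at \<xi> within S)"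
proof -
  obtain y1 where y1: "y \<le> ereal y1" "ereal y1 < L + ereal (snd \<xi>)"
    using ereal_dense2[OF y] by (meson less_imp_le)
  then have "ereal (y1 - snd \<xi>) < L" by (cases L) auto
  then obtain y2 where y2: "ereal (y1 - snd \<xi>) < ereal y2" "ereal y2 < L"
    using ereal_dense2 by blast
  have "eventually (\<lambda>z. ereal y2 < u z) (at \<xi> within S)"
    using L y2 by (auto intro: less_LiminfD less_le_trans)
  moreover have "eventually (\<lambda>z. y1 - y2 < snd z) (at \<xi> within S)"
  proof (rule order_tendstoD)
    show "((\<lambda>z. snd z) \<longlongrightarrow> snd \<xi>) (at \<xi> within S)" by (intro tendsto_intros)
  qed (use y2 in simp)
  ultimately show ?thesis
  proof eventually_elim
    case (elim z)
    have "ereal y1 < ereal y2 + ereal (snd z)" using elim by simp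
    also have "\<dots> \<le> u z + ereal (snd z)" using elim by (intro add_mono) auto
    finally show ?case using y1 by simp
  qed
qed

text \<open>Suppose that v + t has a negative minimum m over \<Theta>, attained at (c, s). On a small box around (c, s)
  with times between t1 < s < t2, the bound v \<ge> m - t leaves room t2 - t1 at the bottom face compared
  with the constant m - t2. A focusing solution centred at c fits into this room: it lies below
  m - t2 on the lateral faces and exceeds m - t2 by a on the axis. Comparison then gives
  v (c, s) \<ge> m - t2 + a > m - s as soon as t2 - s < a, which is a contradiction.

  Boundary data that strictly decrease in time are what creates the room at the bottom face. The same
  data provide both bounds that are needed later: nonnegativity everywhere and a positive lower
  bound on an early time slice, uniformly in v.\<close>

lemma superparabolic_boundary_minimum_principle:
  fixes v :: "(real^'n) \<times> real \<Rightarrow> ereal"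
  assumes p: "p > 2" and bdd: "bounded \<Theta>" and op: "open \<Theta>"
    and v: "p_superparabolic p \<Theta> v"
    and bdry: "\<And>\<xi>. \<xi> \<in> frontier \<Theta> \<Longrightarrow> ereal (- snd \<xi>) \<le> Liminf (at \<xi> within \<Theta>) v"
    and z: "z \<in> \<Theta>"
  shows "ereal (- snd z) \<le> v z"
proof (rule ccontr)
  define w where "w z = v z + ereal (snd z)" for z
  have lsc: "lsc_on \<Theta> v" and fin: "\<And>z. z \<in> \<Theta> \<Longrightarrow> v z \<noteq> - \<infinity>"
    using v by (auto simp: p_superparabolic_def)
  assume "\<not> ereal (- snd z) \<le> v z"
  then have wz: "w z < 0" unfolding w_def by (cases "v z") auto
  have ev: "eventually (\<lambda>\<eta>. y < w \<eta>) (at \<xi> within \<Theta>)" if "\<xi> \<in> \<Theta>" "y < w \<xi>" for \<xi> y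
    using that lsc unfolding w_def lsc_on_def by (intro eventually_less_add_time) auto
  have ev': "eventually (\<lambda>\<eta>. y < w \<eta>) (at \<xi> within \<Theta>)" if "\<xi> \<in> frontier \<Theta>" "y < 0" for \<xi> y
    using that bdry unfolding w_def by (intro eventually_less_add_time[where L="ereal (- snd \<xi>)"])
      (simp_all add: zero_ereal_def)
  define L where "L = {\<eta> \<in> \<Theta>. w \<eta> \<le> w z}"
  have "closed L" unfolding closed_limpt
  proof (intro allI impI)
    fix \<xi> assume lim: "\<xi> islimpt L"
    have sub: "L \<subseteq> \<Theta>" by (auto simp: L_def)
    have no: "\<not> eventually (\<lambda>\<eta>. w z < w \<eta>) (at \<xi> within \<Theta>)"
    proof
      assume "eventually (\<lambda>\<eta>. w z < w \<eta>) (at \<xi> within \<Theta>)"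
      then obtain O' where O': "open O'" "\<xi> \<in> O'"
        "\<forall>\<eta>\<in>O'. \<eta> \<noteq> \<xi> \<longrightarrow> \<eta> \<in> \<Theta> \<longrightarrow> w z < w \<eta>"
        unfolding eventually_at_topological by blast
      then obtain \<eta> where "\<eta> \<in> L" "\<eta> \<in> O'" "\<eta> \<noteq> \<xi>" using lim unfolding islimpt_def by blast
      with O' show False by (auto simp: L_def not_less[symmetric])
    qed
    have "\<xi> \<in> closure \<Theta>"
      using islimpt_subset[OF lim sub] by (simp add: closure_def)
    moreover have "\<xi> \<notin> frontier \<Theta>" using ev'[OF _ wz] no by blast
    ultimately have "\<xi> \<in> \<Theta>" using op by (simp add: frontier_def interior_open)
    moreover have "\<not> w z < w \<xi>" using ev no calculation by blast
    ultimately show "\<xi> \<in> L" by (simp add: L_def)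
  qed
  moreover have "bounded L" using bdd by (rule bounded_subset) (auto simp: L_def)
  ultimately have cL: "compact L" by (simp add: compact_eq_bounded_closed)
  have "z \<in> L" using z by (simp add: L_def)
  then have "L \<noteq> {}" by blast
  moreover have "eventually (\<lambda>\<eta>. y < w \<eta>) (at \<xi> within L)" if "\<xi> \<in> L" "y < w \<xi>" for \<xi> y
    by (rule filter_leD[OF at_le ev]) (use that in \<open>auto simp: L_def\<close>)
  ultimately obtain z0 where z0: "z0 \<in> L" "\<And>\<eta>. \<eta> \<in> L \<Longrightarrow> w z0 \<le> w \<eta>"
    using lower_semicontinuous_attains_inf[OF cL, of w] by blast
  have min: "w z0 \<le> w \<eta>" if "\<eta> \<in> \<Theta>" for \<eta>
  proof (cases "\<eta> \<in> L")
    case False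
    then have "w z < w \<eta>" using that by (auto simp: L_def)
    moreover have "w z0 \<le> w z" using z0 by (auto simp: L_def)
    ultimately show ?thesis by simp
  qed (use z0 in auto)
  have z0\<Theta>: "z0 \<in> \<Theta>" and "w z0 < 0" using z0 wz by (auto simp: L_def)
  obtain c s where cs: "z0 = (c, s)" by force
  obtain \<mu> where \<mu>: "v z0 = ereal \<mu>"
    using fin[OF z0\<Theta>] \<open>w z0 < 0\<close> unfolding w_def by (cases "v z0") auto
  define m where "m = \<mu> + s"
  have vge: "ereal (m - t) \<le> v (x, t)" if "(x, t) \<in> \<Theta>" for x t
  proof -
    have "ereal \<mu> + ereal s \<le> v (x, t) + ereal t"
      using min[OF that] unfolding w_def \<mu> by (simp add: cs)
    then show ?thesis unfolding m_def by (cases "v (x, t)") auto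
  qed
  obtain e where e: "e > 0" "cball z0 e \<subseteq> \<Theta>" using op z0\<Theta> open_contains_cball by blast
  define n where "n = real CARD('n)"
  have n: "n > 0" by (simp add: n_def)
  define r where "r = e / (2 * n)"
  define \<delta> where "\<delta> = e / 2"
  have r: "r > 0" and \<delta>: "\<delta> > 0" using e n by (auto simp: r_def \<delta>_def)
  have sub: "closed_cube c r \<times> {s - \<delta>..s + \<delta>} \<subseteq> \<Theta>"
  proof
    fix z assume "z \<in> closed_cube c r \<times> {s - \<delta>..s + \<delta>}"
    then obtain x t where xt: "z = (x, t)" "x \<in> closed_cube c r" "\<bar>t - s\<bar> \<le> \<delta>" by (auto simp: abs_le_iff)
    have "norm (x - c) \<le> e / 2"
      using norm_le_of_mem_closed_cube[OF xt(2)] n by (simp add: r_def n_def[symmetric])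
    then have "dist x c + dist t s \<le> e" using xt(3) by (simp add: dist_norm \<delta>_def)
    then have "dist z z0 \<le> e"
      unfolding xt cs dist_Pair_Pair using sqrt_sum_squares_le_sum[of "dist x c" "dist t s"] by simp
    then show "z \<in> \<Theta>" using e by (auto simp: dist_commute)
  qed
  \<comment> \<open>k bounds from below the drop of the focusing solution from the axis to the
    lateral faces.\<close>
  define k where "k = focusing_constant p n * (1 + 2 * \<delta>) powr (- 1 / (p - 2)) * r powr (p / (p - 2))"
  have k: "k > 0" unfolding k_def using focusing_constant_pos[OF p, of n] n r \<delta> by simp
  \<comment> \<open>The height must fit below both the lateral drop k and the room t2 - t1 >
    \<delta> at the bottom.\<close>
  define a where "a = min k \<delta>"
  define t1 where "t1 = s - \<delta>"
  define t2 where "t2 = s + a / 2"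
  define T where "T = s + \<delta> + 1"
  have a: "a > 0" "a \<le> k" "a \<le> \<delta>" using k \<delta> by (auto simp: a_def)
  have t: "t1 < s" "s < t2" "t2 \<le> s + \<delta>" "t2 < T" using a \<delta> by (auto simp: t1_def t2_def T_def)
  have sub': "closed_cube c r \<times> {t1..t2} \<subseteq> \<Theta>" using sub t by (auto simp: t1_def)
  have "ereal (focusing p (m - t2 + a) c T (c, s)) \<le> v (c, s)"
  proof (rule superparabolic_ge_focusing[OF p v r _ t(4) sub'])
    show "t1 < t2" "t1 < s" "s < t2" using t by auto
    show "c \<in> cube c r" using r by (simp add: mem_cube)
    fix x assume x: "x \<in> closed_cube c r"
    have "focusing p (m - t2 + a) c T (x, t1) \<le> m - t2 + a" by (rule focusing_le[OF p])
    also have "\<dots> \<le> m - t1" using a by (simp add: t1_def t2_def)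
    finally have "ereal (focusing p (m - t2 + a) c T (x, t1)) \<le> ereal (m - t1)" by simp
    also have "\<dots> \<le> v (x, t1)" using sub' t x by (intro vge) auto
    finally show "ereal (focusing p (m - t2 + a) c T (x, t1)) \<le> v (x, t1)" .
  next
    fix x \<tau> assume x: "x \<in> closed_cube c r" "r \<le> norm (x - c)" "t1 < \<tau>" "\<tau> \<le> t2"
    have "focusing p (m - t2 + a) c T (x, \<tau>) \<le> m - t2 + a
        - focusing_constant p (real CARD('n)) * (T - t1) powr (- 1 / (p - 2)) * r powr (p / (p - 2))"
      using r x t by (intro focusing_le_outside[OF p]) auto
    also have "\<dots> = m - t2 + a - k" by (simp add: k_def n_def T_def t1_def algebra_simps)
    also have "\<dots> \<le> m - \<tau>" using a x by simp
    finally have "ereal (focusing p (m - t2 + a) c T (x, \<tau>)) \<le> ereal (m - \<tau>)" by simp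
    also have "\<dots> \<le> v (x, \<tau>)" using sub' t x by (intro vge) auto
    finally show "ereal (focusing p (m - t2 + a) c T (x, \<tau>)) \<le> v (x, \<tau>)" .
  qed
  then show False using \<mu> a unfolding cs by (simp add: m_def t2_def)
qed

section \<open>Lower bounds along the axis of a paraboloid\<close>

text \<open>The solution \<open>focusing p a 0 0\<close> is at most 0 outside the paraboloid of points (x, t) with
  \<open>norm x < \<rho> * (- t) powr (1 / p)\<close>, and it equals a on the axis. Since v is only compared with solutions
  on boxes, the paraboloid is descended by boxes that shrink with it: the k-th one starts at time
  -\<tau> / 2^k, where it circumscribes the paraboloid, and ends after the next one has started. On
  its lateral faces the focusing solution has become nonpositive, hence lies below v; on its bottom
  the comparison is inherited from the previous box.\<close>

lemma superparabolic_axis_lower_bound: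
  fixes v :: "(real^'n) \<times> real \<Rightarrow> ereal"
  assumes p: "p > 2" and v: "p_superparabolic p \<Theta> v"
    and nonneg: "\<And>z. z \<in> \<Theta> \<Longrightarrow> 0 \<le> v z"
    and \<tau>: "\<tau> > 0" and \<rho>: "\<rho> > 0"
    and paraboloid: "\<And>x t. \<lbrakk>- \<tau> \<le> t; t < 0; norm x \<le> 3 * real CARD('n) * \<rho> * (- t) powr (1 / p)\<rbrakk>
      \<Longrightarrow> (x, t) \<in> \<Theta>"
    and a: "a = focusing_constant p (real CARD('n)) * \<rho> powr (p / (p - 2))"
    and init: "\<And>x. x \<in> closed_cube 0 (\<rho> * \<tau> powr (1 / p)) \<Longrightarrow> ereal a \<le> v (x, - \<tau>)"
  shows "ereal a \<le> v (0, - (\<tau> / 2 ^ k))"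
proof -
  define n where "n = real CARD('n)"
  have n: "n > 0" by (simp add: n_def)
  define \<sigma> where "\<sigma> j = \<tau> / 2 ^ j" for j
  have \<sigma>: "\<sigma> k > 0" "\<sigma> k \<le> \<tau>" "\<sigma> (Suc k) = \<sigma> k / 2" for k
  proof -
    show "\<sigma> k > 0" "\<sigma> (Suc k) = \<sigma> k / 2" using \<tau> by (simp_all add: \<sigma>_def)
    have "\<tau> / 2 ^ k \<le> \<tau> / 1" using \<tau> by (intro divide_left_mono) auto
    then show "\<sigma> k \<le> \<tau>" by (simp add: \<sigma>_def)
  qed
  define r where "r j = \<rho> * \<sigma> j powr (1 / p)" for j
  have r: "r k > 0" for k using \<rho> \<sigma>(1)[of k] by (simp add: r_def)
  have ge: "ereal (focusing p a 0 0 (x, - \<sigma> k)) \<le> v (x, - \<sigma> k)" if "x \<in> closed_cube 0 (r k)" for x k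
    using that
  proof (induction k arbitrary: x)
    case 0
    have "ereal (focusing p a 0 0 (x, - \<sigma> 0)) \<le> ereal a" using focusing_le[OF p] by simp
    also have "\<dots> \<le> v (x, - \<sigma> 0)" using init[of x] 0 by (simp add: r_def \<sigma>_def)
    finally show ?case .
  next
    case (Suc k)
    \<comment> \<open>The top time -\<sigma> k / 3 is later than the next starting time
      -\<sigma> k / 2. Over the duration of the box the paraboloid loses at most a factor
      3^(1/p) \<le> 3 of its radius, which the factor 3 in its assumed width absorbs.\<close>
    have sub: "closed_cube 0 (r k) \<times> {- \<sigma> k..- (\<sigma> k / 3)} \<subseteq> \<Theta>"
    proof
      fix z :: "(real^'n) \<times> real" assume "z \<in> closed_cube 0 (r k) \<times> {- \<sigma> k..- (\<sigma> k / 3)}"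
      then obtain x t where xt: "z = (x, t)" "x \<in> closed_cube 0 (r k)" "- \<sigma> k \<le> t" "t \<le> - (\<sigma> k / 3)"
        by auto
      have "norm x \<le> n * r k" using norm_le_of_mem_closed_cube[OF xt(2)] by (simp add: n_def)
      also have "r k \<le> \<rho> * (3 * (- t)) powr (1 / p)"
        unfolding r_def using xt \<rho> p \<sigma>(1)[of k] by (intro mult_left_mono powr_mono2) auto
      also have "(3 * (- t)) powr (1 / p) = 3 powr (1 / p) * (- t) powr (1 / p)"
        using xt \<sigma>(1)[of k] by (subst powr_mult) auto
      also have "3 powr (1 / p) \<le> (3::real) powr 1" using p by (intro powr_mono) auto
      finally have "norm x \<le> n * (\<rho> * (3 * (- t) powr (1 / p)))"
        using n \<rho> by (simp add: mult_left_mono mult_right_mono)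
      then show "z \<in> \<Theta>" unfolding xt(1) using xt \<sigma>[of k]
        by (intro paraboloid) (auto simp: n_def mult_ac)
    qed
    have lt: "r (Suc k) < r k" unfolding r_def \<sigma>(3)
      using \<rho> p \<sigma>(1)[of k] by (intro mult_strict_left_mono powr_less_mono2) auto
    show ?case unfolding \<sigma>(3)
    proof (rule superparabolic_ge_focusing[OF p v r _ _ sub Suc.IH])
      show "- \<sigma> k < - (\<sigma> k / 3)" "- (\<sigma> k / 3) < 0" "- \<sigma> k < - (\<sigma> k / 2)" "- (\<sigma> k / 2) < - (\<sigma> k / 3)"
        using \<sigma>(1)[of k] by auto
      show "x \<in> cube 0 (r k)" using Suc.prems lt unfolding mem_cube mem_closed_cube
        by (blast intro: le_less_trans)
      fix x :: "real^'n" and t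
      assume x: "x \<in> closed_cube 0 (r k)" "r k \<le> norm (x - 0)" "- \<sigma> k < t" "t \<le> - (\<sigma> k / 3)"
      have "focusing p a 0 0 (x, t) \<le> a - focusing_constant p n * (0 - - \<sigma> k) powr (- 1 / (p - 2)) * r k powr (p / (p - 2))"
        unfolding n_def using x r[of k] \<sigma>(1)[of k] by (intro focusing_le_outside[OF p]) auto
      also have "r k powr (p / (p - 2)) = \<rho> powr (p / (p - 2)) * \<sigma> k powr (1 / (p - 2))"
        unfolding r_def using \<rho> \<sigma>(1)[of k] p by (simp add: powr_mult powr_powr)
      also have "a - focusing_constant p n * (0 - - \<sigma> k) powr (- 1 / (p - 2)) * (\<rho> powr (p / (p - 2)) * \<sigma> k powr (1 / (p - 2))) = 0"
        unfolding a n_def using \<sigma>(1)[of k] by (simp add: powr_minus)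
      finally have "ereal (focusing p a 0 0 (x, t)) \<le> 0" by simp
      also have "\<dots> \<le> v (x, t)" using x sub by (intro nonneg) auto
      finally show "ereal (focusing p a 0 0 (x, t)) \<le> v (x, t)" .
    qed
  qed
  have "0 \<in> closed_cube 0 (r k)" using r[of k] by (simp add: mem_closed_cube)
  from ge[OF this] show ?thesis by (simp add: \<sigma>_def)
qed

lemma obtain_powr_scale:
  fixes K m q \<rho>0 :: real
  assumes "K > 0" "m > 0" "q > 0" "\<rho>0 > 0"
  obtains \<rho> where "0 < \<rho>" "\<rho> \<le> \<rho>0" "K * \<rho> powr q \<le> m"
proof
  let ?\<rho> = "min \<rho>0 ((m / K) powr (1 / q))"
  show "0 < ?\<rho>" "?\<rho> \<le> \<rho>0" using assms by auto
  have "?\<rho> powr q \<le> ((m / K) powr (1 / q)) powr q"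
    using assms by (intro powr_mono2) auto
  also have "\<dots> = m / K" using assms by (simp add: powr_powr)
  finally show "K * ?\<rho> powr q \<le> m" using assms by (simp add: field_simps)
qed

theorem proposition6p2:
  fixes p t0 :: real
    and \<zeta> :: "real \<Rightarrow> real"
    and \<Theta> :: "((real^'n) \<times> real) set"
  assumes p: "p > 2"
    and t0: "t0 < 0"
    and \<Theta>: "\<Theta> = {(x, t). norm x < \<zeta> t \<and> t0 < t \<and> t < 0}"
    and \<zeta>_pos: "\<And>t. t \<in> {t0<..<0} \<Longrightarrow> \<zeta> t > 0"
    and \<zeta>_cont: "continuous_on {t0<..<0} \<zeta>"
    and bdd: "bounded \<Theta>"
    and liminf: "Liminf (at_left 0) (\<lambda>t. ereal ((- t) powr (- 1 / p) * \<zeta> t)) > 0"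
  shows "irregular_point p \<Theta> (0, 0) \<and> \<not> (\<exists>u. traditional_barrier p \<Theta> (0, 0) u)"
proof -
  define n where "n = real CARD('n)"
  define K where "K = focusing_constant p n"
  define q where "q = p / (p - 2)"
  have n: "n > 0" by (simp add: n_def)
  have K: "K > 0" unfolding K_def using p n by (intro focusing_constant_pos) auto
  have q: "q > 0" using p by (simp add: q_def)
  obtain c where c: "0 < c" "ereal c < Liminf (at_left 0) (\<lambda>t. ereal ((- t) powr (- 1 / p) * \<zeta> t))"
    using ereal_dense2[OF liminf] by auto
  from less_LiminfD[OF c(2)]
  have "eventually (\<lambda>t. c < (- t) powr (- 1 / p) * \<zeta> t) (at_left 0)" by simp
  then obtain b where b: "b < 0" "\<And>t. b < t \<Longrightarrow> t < 0 \<Longrightarrow> c < (- t) powr (- 1 / p) * \<zeta> t"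
    unfolding eventually_at_left[of "-1" "0::real", simplified] by auto
  define \<tau> where "\<tau> = - max b t0 / 2"
  have \<tau>: "\<tau> > 0" "t0 < - \<tau>" "b < - \<tau>" using b(1) t0 by (auto simp: \<tau>_def max_def)
  have cone: "(x, t) \<in> \<Theta>" if "- \<tau> \<le> t" "t < 0" "norm x \<le> c * (- t) powr (1 / p)" for x t
  proof -
    have "(- t) powr (1 / p) * c < (- t) powr (1 / p) * ((- t) powr (- 1 / p) * \<zeta> t)"
      using b(2)[of t] that \<tau> by (intro mult_strict_left_mono) auto
    also have "\<dots> = \<zeta> t" using that by (simp add: powr_minus)
    finally show ?thesis using that \<tau> by (auto simp: \<Theta> mult.commute)
  qed
  \<comment> \<open>Cubes of half-side \<open>r\<close> have circumscribed radius at most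
    \<open>n r\<close>, and each box is kept while the paraboloid narrows by a factor of at most
    3.\<close>
  define \<rho>0 where "\<rho>0 = c / (3 * n)"
  have \<rho>0: "\<rho>0 > 0" using c n by (simp add: \<rho>0_def)
  have paraboloid: "(x, t) \<in> \<Theta>"
    if "\<rho> \<le> \<rho>0" "- \<tau> \<le> t" "t < 0" "norm x \<le> 3 * real CARD('n) * \<rho> * (- t) powr (1 / p)" for \<rho> x t
  proof (rule cone)
    have "3 * n * \<rho> \<le> c" using that(1) n by (simp add: \<rho>0_def field_simps)
    then have "3 * n * \<rho> * (- t) powr (1 / p) \<le> c * (- t) powr (1 / p)"
      by (intro mult_right_mono) auto
    then show "norm x \<le> c * (- t) powr (1 / p)" using that(4) by (simp add: n_def)
  qed (use that in auto)
  have slice: "(x, - \<tau>) \<in> \<Theta>"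
    if "\<rho> > 0" "\<rho> \<le> \<rho>0" "x \<in> closed_cube 0 (\<rho> * \<tau> powr (1 / p))" for \<rho> x
  proof (rule paraboloid[OF that(2)])
    have "norm x \<le> n * (\<rho> * \<tau> powr (1 / p))"
      using norm_le_of_mem_closed_cube[OF that(3)] by (simp add: n_def)
    also have "\<dots> \<le> 3 * (n * (\<rho> * \<tau> powr (1 / p)))" using n that by simp
    finally show "norm x \<le> 3 * real CARD('n) * \<rho> * (- (- \<tau>)) powr (1 / p)"
      by (simp add: n_def mult_ac)
  qed (use \<tau> in auto)
  define \<xi> :: "nat \<Rightarrow> (real^'n) \<times> real" where "\<xi> k = (0, - (\<tau> / 2 ^ k))" for k
  have \<xi>\<Theta>: "\<xi> k \<in> \<Theta>" for k
  proof -
    have "\<tau> / 2 ^ k \<le> \<tau> / 1" using \<tau> by (intro divide_left_mono) auto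
    then show ?thesis unfolding \<xi>_def using \<tau> c by (intro cone) auto
  qed
  have \<xi>0: "\<xi> \<longlonglongrightarrow> (0, 0)"
  proof -
    have "(\<lambda>k. \<tau> * (1 / 2) ^ k) \<longlonglongrightarrow> \<tau> * 0"
      by (intro tendsto_mult tendsto_const LIMSEQ_realpow_zero) auto
    then have "(\<lambda>k. - (\<tau> / 2 ^ k)) \<longlonglongrightarrow> - 0"
      by (intro tendsto_minus) (simp add: power_divide)
    then show ?thesis unfolding \<xi>_def by (intro tendsto_Pair) auto
  qed
  have \<xi>lim: "filterlim \<xi> (at (0, 0) within \<Theta>) sequentially"
    unfolding filterlim_at using \<xi>0 \<xi>\<Theta> \<tau> by (auto simp: \<xi>_def)
  have front: "(0, 0) \<in> frontier \<Theta>"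
  proof -
    have "(0, 0) \<in> closure \<Theta>" using \<xi>0 \<xi>\<Theta> closure_sequential by blast
    moreover have "(0, 0) \<notin> interior \<Theta>" using interior_subset[of \<Theta>] by (auto simp: \<Theta>)
    ultimately show ?thesis by (simp add: frontier_def)
  qed
  have op: "open \<Theta>"
  proof -
    have "open ((UNIV::(real^'n) set) \<times> {t0<..<0})" by (intro open_Times) auto
    moreover have "continuous_on (UNIV \<times> {t0<..<0}) (\<lambda>z. \<zeta> (snd z) - norm (fst z :: real^'n))"
      by (intro continuous_intros continuous_on_compose2[OF \<zeta>_cont]) auto
    ultimately have "open (UNIV \<times> {t0<..<0} \<inter> (\<lambda>z. \<zeta> (snd z) - norm (fst z :: real^'n)) -` {0<..})"
      by (intro continuous_open_preimage) auto
    also have "UNIV \<times> {t0<..<0} \<inter> (\<lambda>z. \<zeta> (snd z) - norm (fst z :: real^'n)) -` {0<..} = \<Theta>"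
      by (auto simp: \<Theta>)
    finally show ?thesis .
  qed
  have not_regular: "\<not> regular_point p \<Theta> (0, 0)"
  proof
    assume reg: "regular_point p \<Theta> (0, 0)"
    \<comment> \<open>These boundary values vanish at the origin and increase backwards in
      time.\<close>
    define f where "f z = - snd z" for z :: "(real^'n) \<times> real"
    have "continuous_on (frontier \<Theta>) f" unfolding f_def by (intro continuous_intros)
    then have "(upper_perron p \<Theta> f \<longlongrightarrow> ereal (f (0, 0))) (at (0, 0) within \<Theta>)"
      using reg by (simp add: regular_point_def)
    from filterlim_compose[OF this \<xi>lim]
    have lim: "(\<lambda>k. upper_perron p \<Theta> f (\<xi> k)) \<longlonglongrightarrow> 0"
      by (simp add: f_def zero_ereal_def)
    obtain \<rho> where \<rho>: "0 < \<rho>" "\<rho> \<le> \<rho>0" "K * \<rho> powr q \<le> \<tau>"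
      using obtain_powr_scale[OF K \<tau>(1) q \<rho>0] .
    have "ereal (K * \<rho> powr q) \<le> v (\<xi> k)" if v: "v \<in> upper_class p \<Theta> f" for v k
    proof -
      have v': "p_superparabolic p \<Theta> v" using v by (simp add: upper_class_def)
      have vge: "ereal (- snd z) \<le> v z" if "z \<in> \<Theta>" for z
        using superparabolic_boundary_minimum_principle[OF p bdd op v' _ that] v
        by (simp add: upper_class_def f_def)
      show ?thesis unfolding \<xi>_def K_def n_def q_def
      proof (rule superparabolic_axis_lower_bound[OF p v' _ \<tau>(1) \<rho>(1) paraboloid[OF \<rho>(2)] refl])
        show "0 \<le> v z" if "z \<in> \<Theta>" for z
        proof -
          have "0 \<le> ereal (- snd z)" using that by (auto simp: \<Theta>)
          with vge[OF that] show ?thesis by (rule order_trans[rotated])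
        qed
        fix x :: "real^'n" assume "x \<in> closed_cube 0 (\<rho> * \<tau> powr (1 / p))"
        from vge[OF slice[OF \<rho>(1,2) this]]
        have "ereal \<tau> \<le> v (x, - \<tau>)" by simp
        moreover have "ereal (K * \<rho> powr q) \<le> ereal \<tau>" using \<rho>(3) by simp
        ultimately show "ereal (focusing_constant p (real CARD('n)) * \<rho> powr (p / (p - 2))) \<le> v (x, - \<tau>)"
          unfolding K_def n_def q_def by (rule order_trans[rotated])
      qed
    qed
    then have "ereal (K * \<rho> powr q) \<le> upper_perron p \<Theta> f (\<xi> k)" for k
      unfolding upper_perron_def by (intro INF_greatest)
    then have "ereal (K * \<rho> powr q) \<le> 0"
      by (intro tendsto_lowerbound[OF lim]) auto
    then show False using K \<rho> by (simp add: mult_le_0_iff)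
  qed
  have no_barrier: False if u: "traditional_barrier p \<Theta> (0, 0) u" for u
  proof -
    have u': "p_superparabolic p \<Theta> u" and pos: "\<And>z. z \<in> \<Theta> \<Longrightarrow> 0 < u z"
      and lim0: "(u \<longlongrightarrow> 0) (at (0, 0) within \<Theta>)"
      using u by (auto simp: traditional_barrier_def)
    \<comment> \<open>Positivity and lower semicontinuity bound u from below on a compact piece
      of the initial slice. The piece is chosen before \<rho> because the height of the focusing
      solution, and so \<rho>, depends on this bound.\<close>
    define Q where "Q = closed_cube (0::real^'n) (\<rho>0 * \<tau> powr (1 / p)) \<times> {- \<tau>}"
    have Q\<Theta>: "Q \<subseteq> \<Theta>" using slice[OF \<rho>0 order_refl] by (auto simp: Q_def)
    have "compact Q" unfolding Q_def by (intro compact_Times compact_closed_cube) auto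
    moreover have "(0, - \<tau>) \<in> Q" using \<rho>0 by (auto simp: Q_def mem_closed_cube)
    moreover have "eventually (\<lambda>w. y < u w) (at z within Q)" if "z \<in> Q" "y < u z" for z y
    proof (rule filter_leD[OF at_le lsc_onD])
      show "lsc_on \<Theta> u" using u' by (simp add: p_superparabolic_def)
    qed (use that Q\<Theta> in auto)
    ultimately obtain z where z: "z \<in> Q" "\<And>w. w \<in> Q \<Longrightarrow> u z \<le> u w"
      using lower_semicontinuous_attains_inf[of Q u] by blast
    obtain m where m: "0 < m" "ereal m < u z"
      using ereal_dense2[OF pos[of z]] z Q\<Theta> by auto
    obtain \<rho> where \<rho>: "0 < \<rho>" "\<rho> \<le> \<rho>0" "K * \<rho> powr q \<le> m"
      using obtain_powr_scale[OF K m(1) q \<rho>0] .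
    have "ereal (K * \<rho> powr q) \<le> u (\<xi> k)" for k
      unfolding \<xi>_def K_def n_def q_def
    proof (rule superparabolic_axis_lower_bound[OF p u' _ \<tau>(1) \<rho>(1) paraboloid[OF \<rho>(2)] refl])
      show "0 \<le> u z" if "z \<in> \<Theta>" for z using pos[OF that] by simp
      fix x :: "real^'n" assume x: "x \<in> closed_cube 0 (\<rho> * \<tau> powr (1 / p))"
      have "\<rho> * \<tau> powr (1 / p) \<le> \<rho>0 * \<tau> powr (1 / p)" using \<rho> by (intro mult_right_mono) auto
      then have "(x, - \<tau>) \<in> Q" using x by (auto simp: Q_def mem_closed_cube intro: order_trans)
      then have "ereal m \<le> u (x, - \<tau>)" using z(2) m(2) by (meson less_imp_le order_trans)
      moreover have "ereal (K * \<rho> powr q) \<le> ereal m" using \<rho>(3) by simp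
      ultimately show "ereal (focusing_constant p (real CARD('n)) * \<rho> powr (p / (p - 2))) \<le> u (x, - \<tau>)"
        unfolding K_def n_def q_def by (rule order_trans[rotated])
    qed
    then have "ereal (K * \<rho> powr q) \<le> 0"
      by (intro tendsto_lowerbound[OF filterlim_compose[OF lim0 \<xi>lim]]) auto
    then show False using K \<rho> by (simp add: mult_le_0_iff)
  qed
  show ?thesis using front not_regular no_barrier by (auto simp: irregular_point_def)
qed

end
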